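(* Let $n\ge 3$ be an integer and let $q>1$, $\alpha\ge 0$, $\beta>0$ be real constants such that \[ \begin{cases} \alpha<\dfrac{-(n^{2}+4n-4)+\sqrt{(n^{2}+4n-4)^{2}+64n}}{16} & \text{if } n\ge 4,\\[2mm] \alpha<\dfrac{-7+2\sqrt{13}}{4} & \text{if } n=3, \end{cases} \] \[ \beta\le\sqrt{\frac{2}{q-1-4\alpha/n}}, \qquad q\ge\max\Big\{\frac{8\alpha}{n}+3,\ 3\alpha+\sqrt{9\alpha^{2}+(1-2\alpha)(1+16\alpha/n)}\Big\}. \] Let $u\in C^4(\mathbb{R}^n)$ be a positive function satisfying $-\Delta^{2}u=u^{-q}$ in $\mathbb{R}^n$. Then \[ \Delta u\ge\alpha\frac{|\nabla u|^{2}}{u}+\beta u^{-\frac{q-1}{2}}\quad\text{in }\mathbb{R}^n . \]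
   Context: $\Delta$ is the Euclidean Laplacian on $\mathbb{R}^n$ and $\Delta^2=\Delta\Delta$ is the bilaplacian. *)

theory Defs
  imports "HOL-Analysis.Analysis"
begin

text \<open>The i-th partial derivative, as the Frechet derivative applied to the i-th standard
  basis vector. It is meaningful only where \<open>f\<close> is differentiable; below, every iterated
  use is guarded by \<open>C_k\<close>.\<close>

definition partial_deriv :: "'n \<Rightarrow> (real ^ 'n \<Rightarrow> real) \<Rightarrow> real ^ 'n \<Rightarrow> real" where
  "partial_deriv i f x = frechet_derivative f (at x) (axis i 1)"

text \<open>\<open>C_k k f\<close> means that \<open>f\<close> is of class \<open>C\<^sup>k\<close> on the whole space:
  the derivative exists everywhere and its components are of class \<open>C\<^sup>k\<^sup>-\<^sup>1\<close>.\<close>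

primrec C_k :: "nat \<Rightarrow> (real ^ 'n \<Rightarrow> real) \<Rightarrow> bool" where
  "C_k 0 f \<longleftrightarrow> continuous_on UNIV f"
| "C_k (Suc k) f \<longleftrightarrow> (\<forall>x. f differentiable (at x)) \<and> (\<forall>i. C_k k (partial_deriv i f))"

definition gradient :: "(real ^ 'n \<Rightarrow> real) \<Rightarrow> real ^ 'n \<Rightarrow> real ^ 'n" where
  "gradient f x = (\<chi> i. partial_deriv i f x)"

definition laplacian :: "(real ^ 'n \<Rightarrow> real) \<Rightarrow> real ^ 'n \<Rightarrow> real" where
  "laplacian f x = (\<Sum>i\<in>UNIV. partial_deriv i (partial_deriv i f) x)"

definition bilaplacian :: "(real ^ 'n \<Rightarrow> real) \<Rightarrow> real ^ 'n \<Rightarrow> real" where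
  "bilaplacian f = laplacian (laplacian f)"

text \<open>Agreement with the library's gradient relation.\<close>

lemma GDERIV_gradient:
  fixes f :: "real ^ 'n \<Rightarrow> real"
  assumes "f differentiable (at x)"
  shows "GDERIV f x :> gradient f x"
proof -
  let ?D = "frechet_derivative f (at x)"
  have D: "(f has_derivative ?D) (at x)"
    using assms by (simp add: frechet_derivative_works)
  then have lin: "linear ?D"
    by (rule has_derivative_linear)
  have "?D h = inner h (gradient f x)" for h
  proof -
    have "?D h = ?D (\<Sum>i\<in>UNIV. (h $ i) *\<^sub>R axis i 1)"
      by (simp add: basis_expansion flip: scalar_mult_eq_scaleR)
    also have "\<dots> = (\<Sum>i\<in>UNIV. (h $ i) *\<^sub>R ?D (axis i 1))"
      by (simp add: linear_sum[OF lin] linear_cmul[OF lin])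
    also have "\<dots> = inner h (gradient f x)"
      by (simp add: inner_vec_def gradient_def partial_deriv_def)
    finally show ?thesis .
  qed
  then have "?D = (\<lambda>h. inner h (gradient f x))"
    by blast
  with D show ?thesis
    by (simp add: gderiv_def)
qed

end

theory Submission
  imports Defs
begin

text \<open>
  Put \<open>v = \<Delta>u\<close>, \<open>p = (q - 1) / 2\<close>, \<open>G = |\<nabla>u|\<^sup>2 / u\<close>, \<open>B = u powr (- p)\<close>, and call
  \<open>w = \<alpha> G + \<beta> B - v\<close> the defect. The claim is \<open>w \<le> 0\<close>, and it is a maximum principle.

  Computing \<open>\<Delta>w\<close> produces \<open>(2 \<alpha> / u) |D\<^sup>2u|\<^sup>2\<close>, which after completing a square is bounded below by
  the trace inequality for \<open>D\<^sup>2u - (1 - \<alpha>) \<nabla>u \<nabla>u\<^sup>T / u\<close>. Eliminating \<open>v = \<alpha> G + \<beta> B - w\<close> leaves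
  \<open>u \<Delta>w + 2 \<alpha> \<nabla>u \<bullet> \<nabla>w \<ge> w (2 \<alpha> w / n + c\<^sub>1 G + c\<^sub>2 B) + c\<^sub>3 G\<^sup>2 + c\<^sub>4 G B + c\<^sub>5 B\<^sup>2\<close>.
  The conditions on \<open>q\<close> and \<open>\<beta>\<close> say that \<open>c\<^sub>4\<close> and \<open>c\<^sub>5\<close> are nonnegative and that
  \<open>c\<^sub>2 \<ge> \<beta>\<close>; the conditions on \<open>\<alpha>\<close> enter through \<open>\<alpha> < 1 / 3\<close>, which also gives \<open>c\<^sub>3 \<ge> 0\<close>.

  On the whole space this has to be localized although the drift \<open>\<nabla>u / u\<close> is unbounded and the
  quadratic term degenerates where \<open>u\<close> is large. Both difficulties are overcome by maximizing
  \<open>w u powr (- \<theta>) (R\<^sup>2 - |x - y|\<^sup>2)\<^sup>2\<close> over a ball, with \<open>\<theta> = (1 - 3 \<alpha>) / 2\<close>: the factor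
  \<open>u powr (- \<theta>)\<close> creates an additional \<open>(\<theta> - 3 \<alpha> \<theta> - \<theta>\<^sup>2) G = \<theta>\<^sup>2 G\<close>, which absorbs the cross
  term coming from the cutoff, and an additional \<open>\<theta> w\<close>. At a maximum point \<open>x\<close> this leaves
  \<open>\<theta> w (R\<^sup>2 - |x - y|\<^sup>2)\<^sup>2 \<le> C u R\<^sup>2\<close> (lemma \<open>touching_point_bound\<close>), so that
  \<open>w(y) u(y) powr (- \<theta>) R\<^sup>4 \<le> (C / \<theta>) u(x) powr (1 - \<theta>) R\<^sup>2\<close>. If \<open>u\<close> grows at most
  quadratically, the right-hand side is \<open>O(R powr (4 - 2 \<theta>))\<close>, and \<open>R \<rightarrow> \<infinity>\<close> forces
  \<open>w(y) \<le> 0\<close> (lemma \<open>defect_nonpos\<close>).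

  Quadratic growth (lemma \<open>quadratic_growth\<close>) comes from averages over balls. As \<open>v\<close> is superharmonic,
  its averages around \<open>x\<close> are at most \<open>v(x)\<close>, so those of \<open>u\<close> are at most \<open>u(x)\<close> plus a
  multiple of \<open>v(x) R\<^sup>2\<close>. Positivity of \<open>u\<close> then forces \<open>v \<ge> 0\<close>, so \<open>u\<close> is subharmonic and its
  averages control its pointwise values.
\<close>


section \<open>Partial derivatives and functions of class \<open>C\<^sup>k\<close>\<close>

lemma partial_deriv_eq:
  assumes "(f has_derivative f') (at x)"
  shows "partial_deriv i f x = f' (axis i 1)"
  unfolding partial_deriv_def using frechet_derivative_at[OF assms] by simp

lemma has_derivative_partial_deriv:
  assumes "f differentiable (at x)"
  shows "(f has_derivative (\<lambda>h. \<Sum>i\<in>UNIV. h $ i * partial_deriv i f x)) (at x)"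
  using GDERIV_gradient[OF assms] by (simp add: gderiv_def inner_vec_def gradient_def)

lemma partial_deriv_along_axis:
  fixes f :: "real ^ 'n \<Rightarrow> real"
  assumes "f differentiable (at (x + s *\<^sub>R axis i 1))"
  shows "((\<lambda>s. f (x + s *\<^sub>R axis i 1)) has_real_derivative
           partial_deriv i f (x + s *\<^sub>R axis i 1)) (at s)"
proof -
  let ?z = "x + s *\<^sub>R axis i 1"
  have D: "(f has_derivative (\<lambda>h. \<Sum>j\<in>UNIV. h $ j * partial_deriv j f ?z)) (at ?z)"
    by (rule has_derivative_partial_deriv[OF assms])
  have L: "((\<lambda>s. x + s *\<^sub>R axis i 1) has_derivative (\<lambda>h. h *\<^sub>R axis i 1)) (at s)"
    by (auto intro!: derivative_eq_intros)
  have "((\<lambda>s. f (x + s *\<^sub>R axis i 1)) has_derivative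
      (\<lambda>h. \<Sum>j\<in>UNIV. (h *\<^sub>R axis i 1) $ j * partial_deriv j f ?z)) (at s)"
    using has_derivative_compose[OF L D] .
  moreover have "(h *\<^sub>R axis i 1) $ j * c = (if j = i then h * c else 0)" for h c j
    by (simp add: axis_def)
  then have "(\<lambda>h. \<Sum>j\<in>UNIV. (h *\<^sub>R axis i 1) $ j * partial_deriv j f ?z)
      = (*) (partial_deriv i f ?z)"
    by (simp only: sum.delta finite if_True UNIV_I) (simp add: mult.commute fun_eq_iff)
  ultimately show ?thesis by (simp add: has_field_derivative_def)
qed

lemma C_k_Suc_imp: "C_k (Suc k) f \<Longrightarrow> C_k k f"
proof (induction k arbitrary: f)
  case 0
  then show ?case
    by (auto simp: continuous_on_eq_continuous_at intro: differentiable_imp_continuous_within)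
qed auto

lemma C_k_mono: "C_k m f \<Longrightarrow> k \<le> m \<Longrightarrow> C_k k f"
proof (induction m)
  case (Suc m)
  then show ?case using C_k_Suc_imp[of m f] by (cases "k = Suc m") auto
qed simp

lemma C_k_continuous: "C_k k f \<Longrightarrow> continuous_on UNIV f"
  using C_k_mono[of k f 0] by simp

lemma partial_deriv_sum:
  assumes "finite A" "\<And>a. a \<in> A \<Longrightarrow> F a differentiable (at x)"
  shows "partial_deriv i (\<lambda>x. \<Sum>a\<in>A. F a x) x = (\<Sum>a\<in>A. partial_deriv i (F a) x)"
proof -
  have "((\<lambda>x. \<Sum>a\<in>A. F a x) has_derivative (\<lambda>h. \<Sum>a\<in>A. frechet_derivative (F a) (at x) h)) (at x)"
    using assms by (intro has_derivative_sum) (simp add: frechet_derivative_works)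
  from partial_deriv_eq[OF this] show ?thesis by (simp add: partial_deriv_def)
qed

lemma C_k_sum:
  assumes "finite A" "\<And>a. a \<in> A \<Longrightarrow> C_k k (F a)"
  shows "C_k k (\<lambda>x. \<Sum>a\<in>A. F a x)"
  using assms(2)
proof (induction k arbitrary: F)
  case 0
  then show ?case by (auto intro: continuous_on_sum)
next
  case (Suc k)
  have "partial_deriv i (\<lambda>x. \<Sum>a\<in>A. F a x) = (\<lambda>x. \<Sum>a\<in>A. partial_deriv i (F a) x)" for i
    using Suc.prems by (intro ext partial_deriv_sum) (auto simp: assms(1))
  moreover have "C_k k (\<lambda>x. \<Sum>a\<in>A. partial_deriv i (F a) x)" for i
    using Suc.prems by (intro Suc.IH) auto
  ultimately show ?case
    using Suc.prems assms(1) by (auto intro!: differentiable_sum)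
qed

lemma C_k_laplacian:
  assumes "C_k (Suc (Suc k)) f"
  shows "C_k k (laplacian f)"
  unfolding laplacian_def[abs_def] using assms by (intro C_k_sum) auto

text \<open>Two applications of the mean value theorem, first in direction \<open>i\<close> and then in direction \<open>j\<close>. The
  left-hand side is symmetric in \<open>i\<close> and \<open>j\<close>, so letting \<open>h\<close> tend to zero exchanges the partial
  derivatives.\<close>

lemma second_difference_mean_value:
  fixes f :: "real ^ 'n \<Rightarrow> real"
  assumes f: "C_k 2 f" and h: "h > 0"
  obtains s t where "0 < s" "s < h" "0 < t" "t < h"
    "f (x + h *\<^sub>R axis i 1 + h *\<^sub>R axis j 1) - f (x + h *\<^sub>R axis i 1) - f (x + h *\<^sub>R axis j 1) + f x
      = h * h * partial_deriv j (partial_deriv i f) (x + s *\<^sub>R axis i 1 + t *\<^sub>R axis j 1)"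
proof -
  have d: "f differentiable (at z)" "partial_deriv i f differentiable (at z)" for z
    using f by (auto simp: eval_nat_numeral)
  let ?F = "\<lambda>s. f ((x + h *\<^sub>R axis j 1) + s *\<^sub>R axis i 1) - f (x + s *\<^sub>R axis i 1)"
  let ?F' = "\<lambda>s. partial_deriv i f ((x + h *\<^sub>R axis j 1) + s *\<^sub>R axis i 1)
    - partial_deriv i f (x + s *\<^sub>R axis i 1)"
  have "DERIV ?F s :> ?F' s" for s
    by (intro DERIV_diff partial_deriv_along_axis d)
  then obtain s where s: "0 < s" "s < h" "?F h - ?F 0 = (h - 0) * ?F' s"
    using MVT2[OF h, of ?F ?F'] by blast
  let ?K = "\<lambda>t. partial_deriv i f ((x + s *\<^sub>R axis i 1) + t *\<^sub>R axis j 1)"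
  let ?K' = "\<lambda>t. partial_deriv j (partial_deriv i f) ((x + s *\<^sub>R axis i 1) + t *\<^sub>R axis j 1)"
  have "DERIV ?K t :> ?K' t" for t
    by (intro partial_deriv_along_axis d)
  then obtain t where t: "0 < t" "t < h" "?K h - ?K 0 = (h - 0) * ?K' t"
    using MVT2[OF h, of ?K ?K'] by blast
  have "?F' s = ?K h - ?K 0" by (simp add: ac_simps)
  with s(3) t(3) have "?F h - ?F 0 = h * (h * ?K' t)" by simp
  with s t show ?thesis by (intro that[of s t]) (auto simp: algebra_simps)
qed

lemma partial_deriv_commute:
  fixes f :: "real ^ 'n \<Rightarrow> real"
  assumes f: "C_k 2 f"
  shows "partial_deriv i (partial_deriv j f) x = partial_deriv j (partial_deriv i f) x"
proof (rule ccontr)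
  let ?A = "partial_deriv i (partial_deriv j f)" and ?B = "partial_deriv j (partial_deriv i f)"
  assume ne: "?A x \<noteq> ?B x"
  define e where "e = dist (?A x) (?B x) / 2"
  have e: "e > 0" using ne by (simp add: e_def)
  have "continuous_on UNIV ?A" "continuous_on UNIV ?B"
    using f by (auto simp: eval_nat_numeral)
  then have "isCont ?A x" "isCont ?B x"
    by (auto simp: continuous_on_eq_continuous_at)
  then have "\<exists>d>0. \<forall>y. dist y x < d \<longrightarrow> dist (?A y) (?A x) < e"
    "\<exists>d>0. \<forall>y. dist y x < d \<longrightarrow> dist (?B y) (?B x) < e"
    using e unfolding continuous_at_eps_delta by simp_all
  then obtain d1 d2 where d: "d1 > 0" "d2 > 0"
    and A: "\<And>y. dist y x < d1 \<Longrightarrow> dist (?A y) (?A x) < e"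
    and B: "\<And>y. dist y x < d2 \<Longrightarrow> dist (?B y) (?B x) < e"
    by (elim exE conjE) simp
  define h where "h = min d1 d2 / 3"
  have h: "h > 0" using d by (simp add: h_def)
  have near: "dist (x + s *\<^sub>R axis k 1 + t *\<^sub>R axis l 1) x < min d1 d2"
    if "0 < s" "s < h" "0 < t" "t < h" for s t k l
  proof -
    have "dist (x + s *\<^sub>R axis k 1 + t *\<^sub>R axis l 1) x = norm (s *\<^sub>R axis k 1 + t *\<^sub>R axis l (1::real))"
      by (simp add: dist_norm algebra_simps)
    also have "\<dots> \<le> norm (s *\<^sub>R axis k (1::real)) + norm (t *\<^sub>R axis l (1::real))"
      by (rule norm_triangle_ineq)
    also have "\<dots> = s + t" using that by (simp add: norm_axis_1)
    also have "\<dots> < min d1 d2" using that d by (auto simp: h_def)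
    finally show ?thesis .
  qed
  obtain s t where 1: "0 < s" "s < h" "0 < t" "t < h"
    "f (x + h *\<^sub>R axis i 1 + h *\<^sub>R axis j 1) - f (x + h *\<^sub>R axis i 1) - f (x + h *\<^sub>R axis j 1) + f x
      = h * h * ?B (x + s *\<^sub>R axis i 1 + t *\<^sub>R axis j 1)"
    by (rule second_difference_mean_value[OF f h])
  obtain s' t' where 2: "0 < s'" "s' < h" "0 < t'" "t' < h"
    "f (x + h *\<^sub>R axis j 1 + h *\<^sub>R axis i 1) - f (x + h *\<^sub>R axis j 1) - f (x + h *\<^sub>R axis i 1) + f x
      = h * h * ?A (x + s' *\<^sub>R axis j 1 + t' *\<^sub>R axis i 1)"
    by (rule second_difference_mean_value[OF f h])
  have "h * h * ?A (x + s' *\<^sub>R axis j 1 + t' *\<^sub>R axis i 1)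
      = h * h * ?B (x + s *\<^sub>R axis i 1 + t *\<^sub>R axis j 1)"
  proof -
    have "x + h *\<^sub>R axis j 1 + h *\<^sub>R axis i 1 = x + h *\<^sub>R axis i 1 + h *\<^sub>R axis j (1::real)"
      by (simp add: add_ac)
    from 2(5)[unfolded this] 1(5) show ?thesis by linarith
  qed
  then have "?A (x + s' *\<^sub>R axis j 1 + t' *\<^sub>R axis i 1) = ?B (x + s *\<^sub>R axis i 1 + t *\<^sub>R axis j 1)"
    using h by simp
  moreover have "dist (?A (x + s' *\<^sub>R axis j 1 + t' *\<^sub>R axis i 1)) (?A x) < e"
    using near[OF 2(1-4), of j i] by (intro A) simp
  moreover have "dist (?B (x + s *\<^sub>R axis i 1 + t *\<^sub>R axis j 1)) (?B x) < e"
    using near[OF 1(1-4), of i j] by (intro B) simp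
  ultimately have "dist (?A x) (?B x) < e + e"
    by (metis dist_commute dist_triangle_less_add)
  then show False by (simp add: e_def)
qed

text \<open>This is what turns the third derivatives in the Laplacian of \<open>|\<nabla>u|\<^sup>2\<close> into \<open>\<nabla>u \<bullet> \<nabla>\<Delta>u\<close>.\<close>

lemma laplacian_partial_deriv:
  fixes f :: "real ^ 'n \<Rightarrow> real"
  assumes f: "C_k 3 f"
  shows "laplacian (partial_deriv j f) x = partial_deriv j (laplacian f) x"
proof -
  have f2: "C_k 2 f" using C_k_mono[OF f] by simp
  have f2': "C_k 2 (partial_deriv i f)" for i using f by (simp add: eval_nat_numeral)
  have f3: "partial_deriv i (partial_deriv i f) differentiable (at x)" for i
    using f by (auto simp: eval_nat_numeral)
  have "laplacian (partial_deriv j f) x = (\<Sum>i\<in>UNIV. partial_deriv j (partial_deriv i (partial_deriv i f)) x)"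
    unfolding laplacian_def
  proof (rule sum.cong[OF refl])
    fix i
    have "partial_deriv i (partial_deriv j f) = partial_deriv j (partial_deriv i f)"
      by (rule ext) (rule partial_deriv_commute[OF f2])
    then show "partial_deriv i (partial_deriv i (partial_deriv j f)) x
        = partial_deriv j (partial_deriv i (partial_deriv i f)) x"
      by (simp only: partial_deriv_commute[OF f2', of i j])
  qed
  also have "\<dots> = partial_deriv j (laplacian f) x"
    unfolding laplacian_def[abs_def] by (rule partial_deriv_sum[symmetric]) (simp_all add: f3)
  finally show ?thesis .
qed

text \<open>The maximum principle is reduced to this one-dimensional test on the lines parallel to the axes
  through a maximum point.\<close>

lemma second_derivative_test_local_max:
  fixes f f' :: "real \<Rightarrow> real"
  assumes d: "d > 0" and f: "\<And>s. \<bar>s\<bar> < d \<Longrightarrow> DERIV f s :> f' s"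
    and f': "DERIV f' 0 :> D" and max: "\<And>s. \<bar>s\<bar> < d \<Longrightarrow> f s \<le> f 0"
  shows "f' 0 = 0" "D \<le> 0"
proof -
  show 0: "f' 0 = 0"
    using DERIV_local_max[OF f[of 0] d] max d by simp
  show "D \<le> 0"
  proof (rule ccontr)
    assume "\<not> D \<le> 0"
    then obtain e where e: "e > 0" "\<And>h. 0 < h \<Longrightarrow> h < e \<Longrightarrow> f' 0 < f' (0 + h)"
      using DERIV_pos_inc_right[OF f'] by (metis not_le)
    define r where "r = min d e / 2"
    have r: "0 < r" "r < d" "r < e" using d e by (auto simp: r_def)
    have "\<exists>z. 0 < z \<and> z < r \<and> f r - f 0 = (r - 0) * f' z"
      using r by (intro MVT2) (auto intro: f)
    then obtain z where z: "0 < z" "z < r" "f r - f 0 = (r - 0) * f' z" by blast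
    have "f' z > 0" using e(2)[of z] z r 0 by simp
    then have "f r > f 0" using z r by (simp add: algebra_simps)
    then show False using max[of r] r by simp
  qed
qed



section \<open>Weighted averages over balls\<close>

text \<open>A radial weight with \<open>\<nabla> bump (k + 1) = - 2 (k + 1) y bump k\<close>. Thanks to this relation the derivative
  of a \<open>bump k\<close> average with respect to the radius becomes a \<open>bump (k + 1)\<close> average of the Laplacian
  after an integration by parts, without any integral over a sphere.\<close>

definition bump :: "nat \<Rightarrow> real ^ 'n \<Rightarrow> real" where
  "bump k y = (max 0 (1 - (norm y)\<^sup>2)) ^ k"

abbreviation unit_cube :: "(real ^ 'n) set" where
  "unit_cube \<equiv> cbox (- 1) 1"

text \<open>The average is not normalized: constants are multiplied by the mass of the weight. The cube is only a
  convenient domain of integration containing the support of the weight.\<close>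

definition ball_mean :: "nat \<Rightarrow> (real ^ 'n \<Rightarrow> real) \<Rightarrow> real ^ 'n \<Rightarrow> real \<Rightarrow> real" where
  "ball_mean k f x R = integral unit_cube (\<lambda>y. f (x + R *\<^sub>R y) * bump k y)"

definition bump_mass :: "'n::finite itself \<Rightarrow> nat \<Rightarrow> real" where
  "bump_mass _ k = integral unit_cube (bump k :: real ^ 'n \<Rightarrow> real)"

lemma bump_nonneg: "bump k y \<ge> 0"
  by (simp add: bump_def)

lemma bump_le_1: "bump k y \<le> 1"
  by (auto simp: bump_def intro!: power_le_one)

lemma bump_outside: "k > 0 \<Longrightarrow> norm y \<ge> 1 \<Longrightarrow> bump k y = 0"
proof -
  assume "k > 0" "norm y \<ge> 1"
  then have "(norm y)\<^sup>2 \<ge> 1" by simp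
  then show ?thesis using \<open>k > 0\<close> by (simp add: bump_def max_def)
qed

lemma continuous_on_bump: "continuous_on S (bump k)"
  unfolding bump_def by (intro continuous_intros)

lemma in_unit_cube: "norm y \<le> 1 \<Longrightarrow> y \<in> unit_cube"
proof -
  assume "norm y \<le> 1"
  then have "\<bar>y $ i\<bar> \<le> 1" for i using component_le_norm_cart[of y i] by linarith
  then show ?thesis by (simp add: mem_box_cart abs_le_iff minus_le_iff)
qed

lemma DERIV_positive_part_power:
  assumes "k \<ge> 1"
  shows "((\<lambda>r::real. (max 0 r) ^ Suc k) has_real_derivative real (Suc k) * (max 0 r) ^ k) (at r)"
proof -
  consider "r > 0" | "r < 0" | "r = 0" by linarith
  then show ?thesis
  proof cases
    case 1
    have "((\<lambda>r::real. r ^ Suc k) has_real_derivative real (Suc k) * (max 0 r) ^ k) (at r)"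
    proof -
      have "max 0 r = r" using 1 by simp
      then show ?thesis using DERIV_pow[of "Suc k" r] by (simp del: power_Suc)
    qed
    then show ?thesis
      by (rule has_field_derivative_transform_within_open[where S = "{0<..}"]) (use 1 in auto)
  next
    case 2
    have "((\<lambda>r::real. 0) has_real_derivative real (Suc k) * (max 0 r) ^ k) (at r)"
      using 2 assms by (auto intro!: derivative_eq_intros simp: max_def)
    then show ?thesis
      by (rule has_field_derivative_transform_within_open[where S = "{..<0}"]) (use 2 in auto)
  next
    case 3
    \<comment> \<open>At the kink the power itself serves as the slope function in Caratheodory's criterion.\<close>
    have "isCont (\<lambda>z::real. (max 0 z) ^ k) 0"
      by (intro continuous_intros)
    moreover have "(max 0 z) ^ Suc k - (max 0 0) ^ Suc k = (max 0 z) ^ k * (z - 0)" for z :: real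
      using assms by (auto simp: max_def)
    ultimately have "((\<lambda>r::real. (max 0 r) ^ Suc k) has_real_derivative (max 0 0) ^ k) (at 0)"
      unfolding CARAT_DERIV by (intro exI[of _ "\<lambda>z. (max 0 z) ^ k"]) auto
    then show ?thesis using 3 assms by (simp add: zero_power)
  qed
qed

lemma bump_along_axis:
  fixes y :: "real ^ 'n"
  assumes "k \<ge> 1"
  shows "((\<lambda>s. bump (Suc k) (y + s *\<^sub>R axis i 1)) has_real_derivative
    - 2 * real (Suc k) * (y + s *\<^sub>R axis i 1) $ i * bump k (y + s *\<^sub>R axis i 1)) (at s)"
proof -
  have n: "(norm (y + s *\<^sub>R axis i 1))\<^sup>2 = (norm y)\<^sup>2 + 2 * s * y $ i + s\<^sup>2" for s
    unfolding power2_norm_eq_inner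
    by (simp add: inner_add_left inner_add_right inner_axis inner_axis' power2_eq_square algebra_simps)
  have "((\<lambda>s. 1 - ((norm y)\<^sup>2 + 2 * s * y $ i + s\<^sup>2)) has_real_derivative - 2 * (y $ i + s)) (at s)"
    by (auto intro!: derivative_eq_intros)
  from DERIV_chain'[OF this DERIV_positive_part_power[OF assms]]
  show ?thesis unfolding bump_def n by (simp add: algebra_simps)
qed

text \<open>The divergence theorem for compact support, from translation invariance: the integral of
  \<open>g (y + h e\<^sub>i)\<close> does not depend on \<open>h\<close>, and differentiating under the integral sign at \<open>h = 0\<close>
  gives the integral of the partial derivative.\<close>

lemma integral_partial_deriv_eq_0:
  fixes g g' :: "real ^ 'n \<Rightarrow> real"
  assumes cont: "continuous_on UNIV g" "continuous_on UNIV g'"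
    and der: "\<And>y s. ((\<lambda>s. g (y + s *\<^sub>R axis i 1)) has_real_derivative g' (y + s *\<^sub>R axis i 1)) (at s)"
    and supp: "\<And>y. norm y \<ge> 1 \<Longrightarrow> g y = 0" "\<And>y. norm y \<ge> 1 \<Longrightarrow> g' y = 0"
  shows "integral unit_cube g' = 0"
proof -
  define Q where "Q = cbox (vec (- 2)) (vec 2 :: real ^ 'n)"
  define e where "e = (axis i 1 :: real ^ 'n)"
  define J where "J h = integral Q (\<lambda>y. g (y + h *\<^sub>R e))" for h
  \<comment> \<open>The larger cube contains the supports of all translates with \<open>|h| < 1\<close>.\<close>
  have sub: "unit_cube \<subseteq> Q"
  proof
    fix y :: "real ^ 'n"
    assume "y \<in> unit_cube"
    then have "- 1 \<le> y $ j" "y $ j \<le> 1" for j by (auto simp: mem_box_cart)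
    then have "- 2 \<le> y $ j" "y $ j \<le> 2" for j by (smt (verit))+
    then show "y \<in> Q" unfolding Q_def by (simp add: mem_box_cart)
  qed
  have cg: "continuous_on S (\<lambda>z. g (f z))" "continuous_on S (\<lambda>z. g' (f z))"
    if "continuous_on S f" for S and f :: "'b::topological_space \<Rightarrow> real ^ 'n"
    using cont that by (auto intro: continuous_on_compose2)
  have outside: "norm y \<ge> 1" if "y \<notin> unit_cube" for y :: "real ^ 'n"
    using that in_unit_cube[of y] by linarith
  have J: "J h = integral unit_cube g" if h: "\<bar>h\<bar> < 1" for h
  proof -
    have "(g has_integral integral unit_cube g) unit_cube"
      by (intro integrable_integral integrable_continuous cg[OF continuous_on_id])
    from has_integral_affinity'[OF this, of 1 "h *\<^sub>R e"]
    have I: "((\<lambda>y. g (y + h *\<^sub>R e)) has_integral integral unit_cube g)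
        (cbox (- 1 - h *\<^sub>R e) (1 - h *\<^sub>R e))" by simp
    have "((\<lambda>y. g (y + h *\<^sub>R e)) has_integral integral unit_cube g) Q"
    proof (rule has_integral_on_superset[OF I])
      fix y assume "y \<notin> cbox (- 1 - h *\<^sub>R e) (1 - h *\<^sub>R e)"
      then have "y + h *\<^sub>R e \<notin> unit_cube"
        by (auto simp: mem_box_cart algebra_simps)
      then show "g (y + h *\<^sub>R e) = 0" using supp(1) outside by blast
    next
      show "cbox (- 1 - h *\<^sub>R e) (1 - h *\<^sub>R e) \<subseteq> Q"
      proof
        fix y assume y: "y \<in> cbox (- 1 - h *\<^sub>R e) (1 - h *\<^sub>R e)"
        have "- 2 \<le> y $ j \<and> y $ j \<le> 2" for j
        proof -
          have "- 1 - h * e $ j \<le> y $ j \<and> y $ j \<le> 1 - h * e $ j"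
            using y by (auto simp: mem_box_cart)
          moreover have "\<bar>h * e $ j\<bar> \<le> 1" using h by (auto simp: e_def axis_def)
          ultimately show ?thesis by linarith
        qed
        then show "y \<in> Q" unfolding Q_def by (simp add: mem_box_cart)
      qed
    qed
    then show ?thesis unfolding J_def by (rule integral_unique)
  qed
  have "(J has_field_derivative integral Q (\<lambda>y. g' (y + 0 *\<^sub>R e))) (at 0 within UNIV)"
    unfolding J_def Q_def
  proof (rule leibniz_rule_field_derivative)
    show "((\<lambda>h. g (y + h *\<^sub>R e)) has_field_derivative g' (y + h *\<^sub>R e)) (at h within UNIV)" for h y
      using der[of y h] by (simp add: e_def)
    show "(\<lambda>y. g (y + h *\<^sub>R e)) integrable_on cbox (vec (- 2)) (vec 2)" for h
      by (intro integrable_continuous cg continuous_intros)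
    show "continuous_on (UNIV \<times> cbox (vec (- 2)) (vec 2)) (\<lambda>(h, y). g' (y + h *\<^sub>R e))"
      unfolding split_beta by (intro cg continuous_intros)
  qed auto
  then have "DERIV J 0 :> integral Q g'" by simp
  then have "integral Q g' = 0"
    by (rule DERIV_local_const[where d = 1]) (simp_all add: J)
  moreover have "integral Q g' = integral unit_cube g'"
  proof (rule integral_unique, rule has_integral_on_superset[OF _ _ sub])
    show "(g' has_integral integral unit_cube g') unit_cube"
      by (intro integrable_integral integrable_continuous cg[OF continuous_on_id])
  qed (use supp(2) outside in auto)
  ultimately show ?thesis by simp
qed

lemma continuous_on_mean_integrand:
  assumes "continuous_on UNIV f"
  shows "continuous_on S (\<lambda>y. f (x + R *\<^sub>R y) * bump k y)"
  by (intro continuous_intros continuous_on_bump continuous_on_compose2[OF assms]) auto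

text \<open>Differentiating in the radius gives the average of \<open>y \<bullet> \<nabla>f (x + R y)\<close> against \<open>bump k\<close>. Since
  \<open>y bump k\<close> is a multiple of \<open>\<nabla> bump (k + 1)\<close>, integrating by parts moves the second derivative
  to \<open>f\<close>.\<close>

lemma DERIV_ball_mean:
  fixes f :: "real ^ 'n \<Rightarrow> real"
  assumes f: "C_k 2 f" and k: "k \<ge> 1"
  shows "(ball_mean k f x has_real_derivative
    R / (2 * real (Suc k)) * ball_mean (Suc k) (laplacian f) x R) (at R)"
proof -
  have d: "f differentiable (at z)" "partial_deriv i f differentiable (at z)" for z i
    using f by (auto simp: eval_nat_numeral)
  have c: "continuous_on UNIV f" "continuous_on UNIV (partial_deriv i f)"
    "continuous_on UNIV (partial_deriv i (partial_deriv i f))" for i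
    using f C_k_continuous[of 2 f] C_k_continuous[of 1 "partial_deriv i f"]
    by (auto simp: eval_nat_numeral)
  have cc: "continuous_on S (\<lambda>z. partial_deriv i f (h z))"
    "continuous_on S (\<lambda>z. partial_deriv i (partial_deriv i f) (h z))"
    if "continuous_on S h" for i S and h :: "'b::topological_space \<Rightarrow> real ^ 'n"
    using c(2,3)[of i] that by (auto intro: continuous_on_compose2)
  have cb: "continuous_on S (\<lambda>z. bump l (h z))"
    if "continuous_on S h" for l S and h :: "'b::topological_space \<Rightarrow> real ^ 'n"
    using continuous_on_bump[of UNIV l] that by (auto intro: continuous_on_compose2)
  have der: "(ball_mean k f x has_real_derivative integral unit_cube
      (\<lambda>y. (\<Sum>i\<in>UNIV. y $ i * partial_deriv i f (x + R *\<^sub>R y)) * bump k y)) (at R within UNIV)"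
    unfolding ball_mean_def[abs_def]
  proof (rule leibniz_rule_field_derivative)
    fix R :: real and y :: "real ^ 'n"
    have "((\<lambda>R. x + R *\<^sub>R y) has_derivative (\<lambda>h. h *\<^sub>R y)) (at R)"
      by (auto intro!: derivative_eq_intros)
    from has_derivative_compose[OF this has_derivative_partial_deriv[OF d(1)]]
    have "((\<lambda>R. f (x + R *\<^sub>R y)) has_derivative
        (\<lambda>h. \<Sum>i\<in>UNIV. (h *\<^sub>R y) $ i * partial_deriv i f (x + R *\<^sub>R y))) (at R)" .
    moreover have "(\<lambda>h. \<Sum>i\<in>UNIV. (h *\<^sub>R y) $ i * partial_deriv i f (x + R *\<^sub>R y))
        = (\<lambda>h. (\<Sum>i\<in>UNIV. y $ i * partial_deriv i f (x + R *\<^sub>R y)) * h)"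
    proof
      fix h
      show "(\<Sum>i\<in>UNIV. (h *\<^sub>R y) $ i * partial_deriv i f (x + R *\<^sub>R y))
          = (\<Sum>i\<in>UNIV. y $ i * partial_deriv i f (x + R *\<^sub>R y)) * h"
        unfolding sum_distrib_right by (rule sum.cong) simp_all
    qed
    ultimately have "((\<lambda>R. f (x + R *\<^sub>R y)) has_real_derivative
        (\<Sum>i\<in>UNIV. y $ i * partial_deriv i f (x + R *\<^sub>R y))) (at R)"
      by (simp add: has_field_derivative_def)
    then show "((\<lambda>R. f (x + R *\<^sub>R y) * bump k y) has_real_derivative
        (\<Sum>i\<in>UNIV. y $ i * partial_deriv i f (x + R *\<^sub>R y)) * bump k y) (at R within UNIV)"
      by (rule DERIV_cmult_right)
  next
    show "(\<lambda>y. f (x + R *\<^sub>R y) * bump k y) integrable_on unit_cube" for R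
      by (intro integrable_continuous continuous_on_mean_integrand c)
    show "continuous_on (UNIV \<times> unit_cube)
        (\<lambda>(R, y). (\<Sum>i\<in>UNIV. y $ i * partial_deriv i f (x + R *\<^sub>R y)) * bump k y)"
      unfolding split_beta by (intro continuous_intros cc cb)
  qed auto
  have parts: "2 * real (Suc k) * integral unit_cube (\<lambda>y. y $ i * partial_deriv i f (x + R *\<^sub>R y) * bump k y)
      = R * integral unit_cube (\<lambda>y. partial_deriv i (partial_deriv i f) (x + R *\<^sub>R y) * bump (Suc k) y)"
    for i
  proof -
    let ?a = "\<lambda>y. R * (partial_deriv i (partial_deriv i f) (x + R *\<^sub>R y) * bump (Suc k) y)"
    let ?b = "\<lambda>y. 2 * real (Suc k) * (y $ i * partial_deriv i f (x + R *\<^sub>R y) * bump k y)"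
    have "integral unit_cube (\<lambda>y. ?a y - ?b y) = 0"
    proof (rule integral_partial_deriv_eq_0[where i = i])
      show "continuous_on UNIV (\<lambda>y. partial_deriv i f (x + R *\<^sub>R y) * bump (Suc k) y)"
        "continuous_on UNIV (\<lambda>y. ?a y - ?b y)"
        by (intro continuous_intros cc cb)+
    next
      fix y :: "real ^ 'n" and s :: real
      have "((\<lambda>s. partial_deriv i f ((x + R *\<^sub>R y) + s *\<^sub>R axis i 1)) has_real_derivative
          partial_deriv i (partial_deriv i f) ((x + R *\<^sub>R y) + (R * s) *\<^sub>R axis i 1)) (at (R * s))"
        by (rule partial_deriv_along_axis[OF d(2)])
      moreover have "((\<lambda>s. R * s) has_real_derivative R) (at s)"
        by (auto intro!: derivative_eq_intros)
      ultimately have "((\<lambda>s. partial_deriv i f ((x + R *\<^sub>R y) + (R * s) *\<^sub>R axis i 1)) has_real_derivative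
          partial_deriv i (partial_deriv i f) ((x + R *\<^sub>R y) + (R * s) *\<^sub>R axis i 1) * R) (at s)"
        by (rule DERIV_chain2[where f = "\<lambda>s. partial_deriv i f ((x + R *\<^sub>R y) + s *\<^sub>R axis i 1)"
              and g = "\<lambda>s. R * s"])
      then have 1: "((\<lambda>s. partial_deriv i f (x + R *\<^sub>R (y + s *\<^sub>R axis i 1))) has_real_derivative
          partial_deriv i (partial_deriv i f) (x + R *\<^sub>R (y + s *\<^sub>R axis i 1)) * R) (at s)"
        by (simp add: algebra_simps)
      show "((\<lambda>s. partial_deriv i f (x + R *\<^sub>R (y + s *\<^sub>R axis i 1)) * bump (Suc k) (y + s *\<^sub>R axis i 1))
        has_real_derivative (?a (y + s *\<^sub>R axis i 1) - ?b (y + s *\<^sub>R axis i 1))) (at s)"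
        by (rule DERIV_cong[OF DERIV_mult[OF 1 bump_along_axis[OF k]]]) (simp add: algebra_simps)
    next
      fix y :: "real ^ 'n"
      assume "norm y \<ge> 1"
      then show "partial_deriv i f (x + R *\<^sub>R y) * bump (Suc k) y = 0" "?a y - ?b y = 0"
        using k by (simp_all add: bump_outside)
    qed
    moreover have "integral unit_cube (\<lambda>y. ?a y - ?b y) = integral unit_cube ?a - integral unit_cube ?b"
      by (intro integral_diff integrable_continuous continuous_intros cc cb)
    ultimately show ?thesis by simp
  qed
  have "2 * real (Suc k) * integral unit_cube
        (\<lambda>y. (\<Sum>i\<in>UNIV. y $ i * partial_deriv i f (x + R *\<^sub>R y)) * bump k y)
      = 2 * real (Suc k) * (\<Sum>i\<in>UNIV. integral unit_cube (\<lambda>y. y $ i * partial_deriv i f (x + R *\<^sub>R y) * bump k y))"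
    unfolding sum_distrib_right
    by (subst integral_sum) (auto intro!: integrable_continuous continuous_intros cc cb)
  also have "\<dots> = (\<Sum>i\<in>UNIV. R * integral unit_cube
      (\<lambda>y. partial_deriv i (partial_deriv i f) (x + R *\<^sub>R y) * bump (Suc k) y))"
    by (simp only: sum_distrib_left parts)
  also have "\<dots> = R * ball_mean (Suc k) (laplacian f) x R"
    unfolding ball_mean_def laplacian_def sum_distrib_right
    by (subst integral_sum)
      (auto simp: sum_distrib_left intro!: integrable_continuous continuous_intros cc cb)
  finally have "integral unit_cube (\<lambda>y. (\<Sum>i\<in>UNIV. y $ i * partial_deriv i f (x + R *\<^sub>R y)) * bump k y)
      = R / (2 * real (Suc k)) * ball_mean (Suc k) (laplacian f) x R"
    by (simp add: field_simps)
  with der show ?thesis by simp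
qed

lemma bump_mass_pos: "bump_mass TYPE('n::finite) k > 0"
proof -
  let ?b = "bump k :: real ^ 'n \<Rightarrow> real"
  have int: "(?b has_integral integral unit_cube ?b) unit_cube"
    by (intro integrable_integral integrable_continuous continuous_on_bump)
  have "integral unit_cube ?b \<noteq> 0"
  proof
    assume "integral unit_cube ?b = 0"
    moreover have "box (- 1) (1 :: real ^ 'n) \<noteq> {}"
      by (auto simp: set_eq_iff mem_box_cart intro!: exI[of _ 0])
    ultimately have "?b 0 = 0"
      using int by (intro has_integral_0_cbox_imp_0[of "- 1" 1 ?b])
        (auto simp: bump_nonneg continuous_on_bump in_unit_cube)
    then show False by (simp add: bump_def)
  qed
  moreover have "integral unit_cube ?b \<ge> 0"
    by (intro Henstock_Kurzweil_Integration.integral_nonneg integrable_continuous continuous_on_bump bump_nonneg)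
  ultimately show ?thesis by (simp add: bump_mass_def)
qed

lemma ball_mean_0: "ball_mean k f (x :: real ^ 'n) 0 = f x * bump_mass TYPE('n) k"
  by (simp add: ball_mean_def bump_mass_def)

lemma ball_mean_mono:
  assumes "continuous_on UNIV f" "continuous_on UNIV g" "\<And>z. f z \<le> g z"
  shows "ball_mean k f x R \<le> ball_mean k g x R"
  unfolding ball_mean_def
  by (intro integral_le integrable_continuous continuous_on_mean_integrand assms
      mult_right_mono bump_nonneg)

lemma ball_mean_zero: "ball_mean k (\<lambda>_. 0) x R = 0"
  by (simp add: ball_mean_def)

lemma superharmonic_ball_mean_le:
  fixes f :: "real ^ 'n \<Rightarrow> real"
  assumes f: "C_k 2 f" and sup: "\<And>z. laplacian f z \<le> 0" and "k \<ge> 1" "R \<ge> 0"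
  shows "ball_mean k f x R \<le> f x * bump_mass TYPE('n) k"
proof -
  have c: "continuous_on UNIV (laplacian f)"
    using C_k_laplacian[of 0 f] f by (simp add: eval_nat_numeral)
  have "ball_mean k f x R \<le> ball_mean k f x 0"
  proof (rule DERIV_nonpos_imp_nonincreasing[OF \<open>R \<ge> 0\<close>])
    fix r :: real assume r: "0 \<le> r"
    have "ball_mean (Suc k) (laplacian f) x r \<le> 0"
      using ball_mean_mono[OF c, of "\<lambda>_. 0" "Suc k" x r] sup by (simp add: ball_mean_zero)
    then have "r / (2 * real (Suc k)) * ball_mean (Suc k) (laplacian f) x r \<le> 0"
      using r by (intro mult_nonneg_nonpos) auto
    then show "\<exists>y. (ball_mean k f x has_real_derivative y) (at r) \<and> y \<le> 0"
      using DERIV_ball_mean[OF f \<open>k \<ge> 1\<close>] by blast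
  qed
  then show ?thesis by (simp add: ball_mean_0)
qed

lemma subharmonic_le_ball_mean:
  fixes f :: "real ^ 'n \<Rightarrow> real"
  assumes f: "C_k 2 f" and sub: "\<And>z. laplacian f z \<ge> 0" and "k \<ge> 1" "R \<ge> 0"
  shows "f x * bump_mass TYPE('n) k \<le> ball_mean k f x R"
proof -
  have c: "continuous_on UNIV (laplacian f)"
    using C_k_laplacian[of 0 f] f by (simp add: eval_nat_numeral)
  have "ball_mean k f x 0 \<le> ball_mean k f x R"
  proof (rule DERIV_nonneg_imp_nondecreasing[OF \<open>R \<ge> 0\<close>])
    fix r :: real assume r: "0 \<le> r"
    have "ball_mean (Suc k) (laplacian f) x r \<ge> 0"
      using ball_mean_mono[OF _ c, of "\<lambda>_. 0" "Suc k" x r] sub by (simp add: ball_mean_zero)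
    then have "r / (2 * real (Suc k)) * ball_mean (Suc k) (laplacian f) x r \<ge> 0"
      using r by (intro mult_nonneg_nonneg) auto
    then show "\<exists>y. (ball_mean k f x has_real_derivative y) (at r) \<and> y \<ge> 0"
      using DERIV_ball_mean[OF f \<open>k \<ge> 1\<close>] by blast
  qed
  then show ?thesis by (simp add: ball_mean_0)
qed

text \<open>The radial derivative of the average of \<open>f\<close> is an average of the superharmonic function \<open>\<Delta>f\<close>, hence at
  most \<open>R\<close> times a multiple of its value at the centre; integrate this in \<open>R\<close>.\<close>

lemma ball_mean_quadratic_bound:
  fixes f :: "real ^ 'n \<Rightarrow> real"
  assumes f: "C_k 4 f" and sup: "\<And>z. bilaplacian f z \<le> 0" and k: "k \<ge> 1" and R: "R \<ge> 0"
  shows "ball_mean k f x R \<le> f x * bump_mass TYPE('n) k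
    + laplacian f x * bump_mass TYPE('n) (Suc k) / (4 * real (Suc k)) * R\<^sup>2"
proof -
  have f2: "C_k 2 f" "C_k 2 (laplacian f)"
    using f C_k_mono[OF f, of 2] C_k_laplacian[of 2 f] by (simp_all add: eval_nat_numeral)
  define c where "c = laplacian f x * bump_mass TYPE('n) (Suc k) / (4 * real (Suc k))"
  have "ball_mean k f x R - c * R\<^sup>2 \<le> ball_mean k f x 0 - c * 0\<^sup>2"
  proof (rule DERIV_nonpos_imp_nonincreasing[OF \<open>R \<ge> 0\<close>])
    fix r :: real assume r: "0 \<le> r"
    have 1: "((\<lambda>r. ball_mean k f x r - c * r\<^sup>2) has_real_derivative
       r / (2 * real (Suc k)) * ball_mean (Suc k) (laplacian f) x r - c * (2 * r)) (at r)"
      by (rule DERIV_diff[OF DERIV_ball_mean[OF f2(1) k]]) (auto intro!: derivative_eq_intros)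
    have "ball_mean (Suc k) (laplacian f) x r \<le> laplacian f x * bump_mass TYPE('n) (Suc k)"
      using sup r by (intro superharmonic_ball_mean_le f2) (auto simp: bilaplacian_def)
    then have "r / (2 * real (Suc k)) * ball_mean (Suc k) (laplacian f) x r
        \<le> r / (2 * real (Suc k)) * (laplacian f x * bump_mass TYPE('n) (Suc k))"
      using r by (intro mult_left_mono) auto
    also have "\<dots> = c * (2 * r)"
      by (simp add: c_def field_simps del: of_nat_Suc)
    finally have "r / (2 * real (Suc k)) * ball_mean (Suc k) (laplacian f) x r - c * (2 * r) \<le> 0"
      by simp
    with 1 show "\<exists>y. ((\<lambda>r. ball_mean k f x r - c * r\<^sup>2) has_real_derivative y) (at r) \<and> y \<le> 0"
      by blast
  qed
  then show ?thesis by (simp add: ball_mean_0 c_def)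
qed

text \<open>If \<open>\<Delta>u(x) < 0\<close>, the quadratic bound makes the averages of \<open>u\<close> around \<open>x\<close> negative for large
  radii, which is impossible for a positive function.\<close>

lemma laplacian_nonneg:
  fixes u :: "real ^ 'n \<Rightarrow> real"
  assumes u: "C_k 4 u" and pos: "\<And>z. u z > 0" and sup: "\<And>z. bilaplacian u z \<le> 0"
  shows "laplacian u x \<ge> 0"
proof (rule ccontr)
  assume "\<not> laplacian u x \<ge> 0"
  then have neg: "laplacian u x < 0" by simp
  define a where "a = u x * bump_mass TYPE('n) 1"
  define c where "c = - (laplacian u x * bump_mass TYPE('n) (Suc 1) / (4 * real (Suc 1)))"
  have c: "c > 0" using neg bump_mass_pos[where 'n='n, of "Suc 1"]
    by (auto simp: c_def field_simps mult_less_0_iff mult_neg_pos)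
  have a: "a > 0" using pos bump_mass_pos[where 'n='n, of 1] by (simp add: a_def)
  \<comment> \<open>At this radius the bound \<open>a - c R\<^sup>2\<close> equals \<open>- a\<close>.\<close>
  define R where "R = sqrt (2 * a / c)"
  have R: "R \<ge> 0" "R\<^sup>2 = 2 * a / c" using a c by (auto simp: R_def)
  have "0 \<le> ball_mean 1 u x R"
    using ball_mean_mono[of "\<lambda>_. 0" u 1 x R] C_k_continuous[OF u] pos
    by (simp add: ball_mean_zero less_imp_le)
  also have "\<dots> \<le> a - c * R\<^sup>2"
    using ball_mean_quadratic_bound[OF u sup _ R(1), of 1 x] by (simp add: a_def c_def)
  also have "\<dots> = - a" using c by (simp add: R)
  finally show False using a by simp
qed

text \<open>A ball of radius \<open>R\<close> around \<open>z\<close> lies in the ball of radius \<open>2 R\<close> around \<open>x\<close>, where the weight of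
  the average of radius \<open>4 R\<close> around \<open>x\<close> is at least \<open>3 / 4\<close>. The factor \<open>4 ^ CARD('n)\<close> is the
  Jacobian of the substitution \<open>z + R y' = x + 4 R y\<close>.\<close>

lemma subharmonic_le_ball_mean_nearby:
  fixes f :: "real ^ 'n \<Rightarrow> real"
  assumes f: "C_k 2 f" and sub: "\<And>z. laplacian f z \<ge> 0" and pos: "\<And>z. f z \<ge> 0"
    and R: "R > 0" and z: "dist x z \<le> R"
  shows "f z * bump_mass TYPE('n) 1 \<le> 2 * 4 ^ CARD('n) * ball_mean 1 f x (4 * R)"
proof -
  define c where "c = (x - z) /\<^sub>R R"
  have "norm c = norm (x - z) / R" using R by (simp add: c_def divide_inverse)
  then have c: "norm c \<le> 1" using R z by (simp add: dist_norm)
  define g where "g y = f (z + R *\<^sub>R y) * bump 1 y" for y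
  have cf: "continuous_on UNIV f" using C_k_continuous[OF f] .
  have cg: "continuous_on S g" for S
    unfolding g_def by (rule continuous_on_mean_integrand[OF cf])
  have "(g has_integral ball_mean 1 f z R) unit_cube"
    unfolding ball_mean_def g_def
    by (intro integrable_integral integrable_continuous continuous_on_mean_integrand cf)
  from has_integral_affinity'[OF this, of 4 c]
  have I: "((\<lambda>y. g (4 *\<^sub>R y + c)) has_integral ball_mean 1 f z R / 4 ^ CARD('n))
      (cbox ((- 1 - c) /\<^sub>R 4) ((1 - c) /\<^sub>R 4))"
    by (simp only: zero_less_numeral DIM_cart DIM_real mult_1_right real_scaleR_def divide_inverse mult.commute[of "inverse _"])
  have J: "((\<lambda>y. g (4 *\<^sub>R y + c)) has_integral ball_mean 1 f z R / 4 ^ CARD('n)) unit_cube"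
  proof (rule has_integral_on_superset[OF I])
    fix y assume y: "y \<notin> cbox ((- 1 - c) /\<^sub>R 4) ((1 - c) /\<^sub>R 4)"
    have "4 *\<^sub>R y + c \<notin> unit_cube"
    proof
      assume *: "4 *\<^sub>R y + c \<in> unit_cube"
      have "((- 1 - c) /\<^sub>R 4) $ i \<le> y $ i \<and> y $ i \<le> ((1 - c) /\<^sub>R 4) $ i" for i
        using *[unfolded mem_box_cart, rule_format, of i] by simp
      then show False using y by (simp add: mem_box_cart)
    qed
    then have "norm (4 *\<^sub>R y + c) \<ge> 1" using in_unit_cube[of "4 *\<^sub>R y + c"] by linarith
    then show "g (4 *\<^sub>R y + c) = 0" by (simp add: g_def bump_outside)
  next
    show "cbox ((- 1 - c) /\<^sub>R 4) ((1 - c) /\<^sub>R 4) \<subseteq> unit_cube"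
    proof
      fix y assume y: "y \<in> cbox ((- 1 - c) /\<^sub>R 4) ((1 - c) /\<^sub>R 4)"
      have "- 1 \<le> y $ i \<and> y $ i \<le> 1" for i
      proof -
        have "(- 1 - c $ i) / 4 \<le> y $ i \<and> y $ i \<le> (1 - c $ i) / 4"
          using y[unfolded mem_box_cart, rule_format, of i] by simp
        then have "- 1 - c $ i \<le> 4 * y $ i \<and> 4 * y $ i \<le> 1 - c $ i"
          by (simp add: field_simps)
        moreover have "\<bar>c $ i\<bar> \<le> 1" using c component_le_norm_cart[of c i] by linarith
        ultimately show ?thesis by linarith
      qed
      then show "y \<in> unit_cube" by (simp add: mem_box_cart)
    qed
  qed
  have K: "((\<lambda>y. 2 * (f (x + (4 * R) *\<^sub>R y) * bump 1 y)) has_integral 2 * ball_mean 1 f x (4 * R)) unit_cube"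
    unfolding ball_mean_def
    by (intro has_integral_mult_right integrable_integral integrable_continuous continuous_on_mean_integrand cf)
  \<comment> \<open>Where the left weight lives, \<open>|y| \<le> 1 / 2\<close> and the right weight is at least \<open>1 / 2\<close>.\<close>
  have le: "g (4 *\<^sub>R y + c) \<le> 2 * (f (x + (4 * R) *\<^sub>R y) * bump 1 y)" for y
  proof (cases "norm (4 *\<^sub>R y + c) \<le> 1")
    case True
    have "norm (4 *\<^sub>R y) \<le> norm (4 *\<^sub>R y + c) + norm c"
      using norm_triangle_ineq4[of "4 *\<^sub>R y + c" c] by simp
    with True c have y: "norm y \<le> 1 / 2" by simp
    have "(norm y)\<^sup>2 \<le> (1 / 2)\<^sup>2" by (rule power_mono[OF y]) simp
    then have "1 / 2 \<le> bump 1 y" by (simp add: bump_def power2_eq_square)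
    then have "bump 1 (4 *\<^sub>R y + c) \<le> 2 * bump 1 y" using bump_le_1[of 1 "4 *\<^sub>R y + c"] by linarith
    moreover have "z + R *\<^sub>R (4 *\<^sub>R y + c) = x + (4 * R) *\<^sub>R y"
      using R by (simp add: c_def algebra_simps)
    ultimately have "g (4 *\<^sub>R y + c) \<le> f (x + (4 * R) *\<^sub>R y) * (2 * bump 1 y)"
      unfolding g_def by (simp only: mult_left_mono[OF _ pos])
    then show ?thesis by simp
  next
    case False
    then show ?thesis using pos[of "x + (4 * R) *\<^sub>R y"] bump_nonneg[of 1 y]
      by (simp add: g_def bump_outside)
  qed
  have "ball_mean 1 f z R / 4 ^ CARD('n) \<le> 2 * ball_mean 1 f x (4 * R)"
    by (rule has_integral_le[OF J K le])
  moreover have "f z * bump_mass TYPE('n) 1 \<le> ball_mean 1 f z R"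
    using R by (intro subharmonic_le_ball_mean f sub) auto
  ultimately show ?thesis by (simp add: field_simps)
qed

lemma quadratic_growth:
  fixes u :: "real ^ 'n \<Rightarrow> real"
  assumes u: "C_k 4 u" and pos: "\<And>z. u z > 0" and sup: "\<And>z. bilaplacian u z \<le> 0"
  obtains K where "K > 0" "\<And>R z. R \<ge> 1 \<Longrightarrow> dist x z \<le> R \<Longrightarrow> u z \<le> K * R\<^sup>2"
proof -
  have u2: "C_k 2 u" using C_k_mono[OF u] by simp
  define m where "m = bump_mass TYPE('n) 1"
  have m: "m > 0" unfolding m_def by (rule bump_mass_pos)
  define c where "c = laplacian u x * bump_mass TYPE('n) (Suc 1) / (4 * real (Suc 1))"
  have c: "c \<ge> 0"
    unfolding c_def using laplacian_nonneg[OF u pos sup, of x] bump_mass_pos[where 'n='n, of "Suc 1"]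
    by (intro divide_nonneg_nonneg mult_nonneg_nonneg) auto
  define K where "K = 2 * 4 ^ CARD('n) * (u x * m + 16 * c) / m"
  show ?thesis
  proof
    show "K > 0" using m c pos[of x] by (auto simp: K_def intro!: divide_pos_pos mult_pos_pos add_pos_nonneg)
  next
    fix R :: real and z assume R: "R \<ge> 1" and z: "dist x z \<le> R"
    have R2: "1 \<le> R\<^sup>2" using R by simp
    have "u z * m \<le> 2 * 4 ^ CARD('n) * ball_mean 1 u x (4 * R)"
      unfolding m_def using laplacian_nonneg[OF u pos sup] pos R z
      by (intro subharmonic_le_ball_mean_nearby[OF u2]) (auto simp: less_imp_le)
    also have "ball_mean 1 u x (4 * R) \<le> u x * m + c * (4 * R)\<^sup>2"
      unfolding m_def c_def using R by (intro ball_mean_quadratic_bound u sup) auto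
    also have "u x * m + c * (4 * R)\<^sup>2 \<le> (u x * m + 16 * c) * R\<^sup>2"
      using mult_left_mono[OF R2, of "u x * m"] pos[of x] m by (simp add: algebra_simps)
    finally show "u z \<le> K * R\<^sup>2" using m by (simp add: K_def field_simps)
  qed
qed



section \<open>The defect and its derivatives\<close>

text \<open>The function whose nonpositivity is the assertion of the theorem, with \<open>p = (q - 1) / 2\<close>.\<close>

definition defect :: "real \<Rightarrow> real \<Rightarrow> real \<Rightarrow> (real ^ 'n \<Rightarrow> real) \<Rightarrow> real ^ 'n \<Rightarrow> real" where
  "defect \<alpha> \<beta> p u x =
     \<alpha> * (norm (gradient u x))\<^sup>2 / u x + \<beta> * u x powr (- p) - laplacian u x"

definition defect_partial ::
  "real \<Rightarrow> real \<Rightarrow> real \<Rightarrow> (real ^ 'n \<Rightarrow> real) \<Rightarrow> 'n \<Rightarrow> real ^ 'n \<Rightarrow> real" where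
  "defect_partial \<alpha> \<beta> p u i x =
     \<alpha> * (2 * (\<Sum>j\<in>UNIV. partial_deriv j u x * partial_deriv i (partial_deriv j u) x) / u x
       - (\<Sum>j\<in>UNIV. (partial_deriv j u x)\<^sup>2) * partial_deriv i u x / (u x)\<^sup>2)
     - \<beta> * p * u x powr (- p - 1) * partial_deriv i u x - partial_deriv i (laplacian u) x"

definition defect_second_partial ::
  "real \<Rightarrow> real \<Rightarrow> real \<Rightarrow> (real ^ 'n \<Rightarrow> real) \<Rightarrow> 'n \<Rightarrow> real ^ 'n \<Rightarrow> real" where
  "defect_second_partial \<alpha> \<beta> p u i x =
     \<alpha> * (2 * (\<Sum>j\<in>UNIV. (partial_deriv i (partial_deriv j u) x)\<^sup>2
               + partial_deriv j u x * partial_deriv i (partial_deriv i (partial_deriv j u)) x) / u x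
       - 4 * (\<Sum>j\<in>UNIV. partial_deriv j u x * partial_deriv i (partial_deriv j u) x)
           * partial_deriv i u x / (u x)\<^sup>2
       - (\<Sum>j\<in>UNIV. (partial_deriv j u x)\<^sup>2) * partial_deriv i (partial_deriv i u) x / (u x)\<^sup>2
       + 2 * (\<Sum>j\<in>UNIV. (partial_deriv j u x)\<^sup>2) * (partial_deriv i u x)\<^sup>2 / (u x) ^ 3)
     - \<beta> * p * (u x powr (- p - 1) * partial_deriv i (partial_deriv i u) x
         - (p + 1) * u x powr (- p - 2) * (partial_deriv i u x)\<^sup>2)
     - partial_deriv i (partial_deriv i (laplacian u)) x"

lemma norm_gradient_square: "(norm (gradient u x))\<^sup>2 = (\<Sum>j\<in>UNIV. (partial_deriv j u x)\<^sup>2)"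
  unfolding power2_norm_eq_inner by (simp add: inner_vec_def gradient_def power2_eq_square)

lemma defect_along_axis:
  fixes u :: "real ^ 'n \<Rightarrow> real"
  assumes u: "C_k 4 u" and pos: "\<And>z. u z > 0"
  shows "((\<lambda>s. defect \<alpha> \<beta> p u (x + s *\<^sub>R axis i 1)) has_real_derivative
      defect_partial \<alpha> \<beta> p u i (x + s *\<^sub>R axis i 1)) (at s)"
    and "((\<lambda>s. defect_partial \<alpha> \<beta> p u i (x + s *\<^sub>R axis i 1)) has_real_derivative
      defect_second_partial \<alpha> \<beta> p u i (x + s *\<^sub>R axis i 1)) (at s)"
proof -
  define e where "e = (axis i 1 :: real ^ 'n)"
  have v: "C_k 2 (laplacian u)" using C_k_laplacian[of 2 u] u by (simp add: eval_nat_numeral)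
  have du: "u differentiable (at z)" "partial_deriv j u differentiable (at z)"
     "partial_deriv k (partial_deriv j u) differentiable (at z)" for j k z
    using u by (auto simp: eval_nat_numeral)
  have dv: "laplacian u differentiable (at z)" "partial_deriv k (laplacian u) differentiable (at z)" for k z
    using v by (auto simp: eval_nat_numeral)
  note line = partial_deriv_along_axis[where i = i and x = x, folded e_def]
  note a = line[OF du(1)] and b = line[OF du(2)] and c = line[OF du(3)]
  note l = line[OF dv(1)] and m = line[OF dv(2)]
  have ne: "u z \<noteq> 0" for z using pos[of z] by simp
  have b2: "((\<lambda>s. \<Sum>j\<in>UNIV. (partial_deriv j u (x + s *\<^sub>R e))\<^sup>2) has_real_derivative
      2 * (\<Sum>j\<in>UNIV. partial_deriv j u (x + s *\<^sub>R e) * partial_deriv i (partial_deriv j u) (x + s *\<^sub>R e))) (at s)"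
    for s
  proof (rule DERIV_cong[OF DERIV_sum])
    show "((\<lambda>s. (partial_deriv j u (x + s *\<^sub>R e))\<^sup>2) has_real_derivative
      2 * partial_deriv j u (x + s *\<^sub>R e) * partial_deriv i (partial_deriv j u) (x + s *\<^sub>R e)) (at s)" for j
      by (rule derivative_eq_intros b | simp)+
  qed (simp add: sum_distrib_left mult.assoc)
  have bc: "((\<lambda>s. \<Sum>j\<in>UNIV. partial_deriv j u (x + s *\<^sub>R e) * partial_deriv i (partial_deriv j u) (x + s *\<^sub>R e))
      has_real_derivative (\<Sum>j\<in>UNIV. (partial_deriv i (partial_deriv j u) (x + s *\<^sub>R e))\<^sup>2
       + partial_deriv j u (x + s *\<^sub>R e) * partial_deriv i (partial_deriv i (partial_deriv j u)) (x + s *\<^sub>R e))) (at s)"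
    for s
    by (rule DERIV_sum, rule DERIV_cong[OF DERIV_mult[OF b c]]) (simp add: power2_eq_square mult.commute)
  have powr: "((\<lambda>s. u (x + s *\<^sub>R e) powr r) has_real_derivative
      r * u (x + s *\<^sub>R e) powr (r - 1) * partial_deriv i u (x + s *\<^sub>R e)) (at s)" for r s
  proof -
    have "((\<lambda>z. z powr r) has_real_derivative r * u (x + s *\<^sub>R e) powr (r - 1)) (at (u (x + s *\<^sub>R e)))"
      by (rule has_real_derivative_powr[OF pos])
    from DERIV_chain'[OF a this] show ?thesis by (simp add: mult.commute)
  qed
  show "((\<lambda>s. defect \<alpha> \<beta> p u (x + s *\<^sub>R axis i 1)) has_real_derivative
      defect_partial \<alpha> \<beta> p u i (x + s *\<^sub>R axis i 1)) (at s)"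
    unfolding defect_def norm_gradient_square e_def[symmetric]
    by (rule DERIV_cong, (rule DERIV_add DERIV_diff DERIV_cmult DERIV_divide b2 a powr l ne)+)
       (simp add: defect_partial_def ne field_simps power2_eq_square)
  show "((\<lambda>s. defect_partial \<alpha> \<beta> p u i (x + s *\<^sub>R axis i 1)) has_real_derivative
      defect_second_partial \<alpha> \<beta> p u i (x + s *\<^sub>R axis i 1)) (at s)"
    unfolding defect_partial_def e_def[symmetric]
  proof (rule DERIV_cong)
    let ?z = "x + s *\<^sub>R e"
    let ?a = "u ?z" and ?g = "partial_deriv i u ?z" and ?h = "partial_deriv i (partial_deriv i u) ?z"
    let ?S = "\<Sum>j\<in>UNIV. (partial_deriv j u ?z)\<^sup>2"
    let ?S1 = "\<Sum>j\<in>UNIV. partial_deriv j u ?z * partial_deriv i (partial_deriv j u) ?z"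
    let ?S2 = "\<Sum>j\<in>UNIV. (partial_deriv i (partial_deriv j u) ?z)\<^sup>2
       + partial_deriv j u ?z * partial_deriv i (partial_deriv i (partial_deriv j u)) ?z"
    have sq: "((\<lambda>s. (u (x + s *\<^sub>R e))\<^sup>2) has_real_derivative 2 * ?a * ?g) (at s)"
      by (rule derivative_eq_intros a | simp)+
    have A: "((\<lambda>s. 2 * (\<Sum>j\<in>UNIV. partial_deriv j u (x + s *\<^sub>R e)
          * partial_deriv i (partial_deriv j u) (x + s *\<^sub>R e)) / u (x + s *\<^sub>R e))
        has_real_derivative (2 * ?S2 * ?a - 2 * ?S1 * ?g) / (?a * ?a)) (at s)"
      by (rule DERIV_divide[OF DERIV_cmult[OF bc] a ne])
    have B: "((\<lambda>s. (\<Sum>j\<in>UNIV. (partial_deriv j u (x + s *\<^sub>R e))\<^sup>2) * partial_deriv i u (x + s *\<^sub>R e)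
          / (u (x + s *\<^sub>R e))\<^sup>2)
        has_real_derivative ((2 * ?S1 * ?g + ?h * ?S) * ?a\<^sup>2 - ?S * ?g * (2 * ?a * ?g)) / (?a\<^sup>2 * ?a\<^sup>2)) (at s)"
      by (rule DERIV_divide[OF DERIV_mult[OF b2 b] sq]) (simp add: ne)
    have C: "((\<lambda>s. \<beta> * p * u (x + s *\<^sub>R e) powr (- p - 1) * partial_deriv i u (x + s *\<^sub>R e))
        has_real_derivative \<beta> * p * ((- p - 1) * ?a powr (- p - 1 - 1) * ?g) * ?g
          + ?h * (\<beta> * p * ?a powr (- p - 1))) (at s)"
      by (rule DERIV_mult[OF DERIV_cmult[OF powr] b])
    show "((\<lambda>s. \<alpha> * (2 * (\<Sum>j\<in>UNIV. partial_deriv j u (x + s *\<^sub>R e)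
          * partial_deriv i (partial_deriv j u) (x + s *\<^sub>R e)) / u (x + s *\<^sub>R e) -
          (\<Sum>j\<in>UNIV. (partial_deriv j u (x + s *\<^sub>R e))\<^sup>2) * partial_deriv i u (x + s *\<^sub>R e)
          / (u (x + s *\<^sub>R e))\<^sup>2) -
        \<beta> * p * u (x + s *\<^sub>R e) powr (- p - 1) * partial_deriv i u (x + s *\<^sub>R e) -
        partial_deriv i (laplacian u) (x + s *\<^sub>R e)) has_real_derivative
      \<alpha> * ((2 * ?S2 * ?a - 2 * ?S1 * ?g) / (?a * ?a)
        - ((2 * ?S1 * ?g + ?h * ?S) * ?a\<^sup>2 - ?S * ?g * (2 * ?a * ?g)) / (?a\<^sup>2 * ?a\<^sup>2))
      - (\<beta> * p * ((- p - 1) * ?a powr (- p - 1 - 1) * ?g) * ?g + ?h * (\<beta> * p * ?a powr (- p - 1)))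
      - partial_deriv i (partial_deriv i (laplacian u)) ?z) (at s)"
      by (intro DERIV_diff DERIV_cmult A B C m)
    have 1: "(2 * ?S2 * ?a - 2 * ?S1 * ?g) / (?a * ?a)
        - ((2 * ?S1 * ?g + ?h * ?S) * ?a\<^sup>2 - ?S * ?g * (2 * ?a * ?g)) / (?a\<^sup>2 * ?a\<^sup>2)
      = 2 * ?S2 / ?a - 4 * ?S1 * ?g / ?a\<^sup>2 - ?S * ?h / ?a\<^sup>2 + 2 * ?S * ?g\<^sup>2 / ?a ^ 3"
    proof -
      have *: "(2 * s2 * w - 2 * s1 * g) / (w * w) - ((2 * s1 * g + h * s) * w\<^sup>2 - s * g * (2 * w * g)) / (w\<^sup>2 * w\<^sup>2)
        = 2 * s2 / w - 4 * s1 * g / w\<^sup>2 - s * h / w\<^sup>2 + 2 * s * g\<^sup>2 / w ^ 3" if "w \<noteq> 0"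
        for s2 s1 s g h w :: real
        using that by (simp add: divide_simps) (simp add: algebra_simps eval_nat_numeral)
      show ?thesis by (rule *) (rule ne)
    qed
    show "\<alpha> * ((2 * ?S2 * ?a - 2 * ?S1 * ?g) / (?a * ?a)
        - ((2 * ?S1 * ?g + ?h * ?S) * ?a\<^sup>2 - ?S * ?g * (2 * ?a * ?g)) / (?a\<^sup>2 * ?a\<^sup>2))
      - (\<beta> * p * ((- p - 1) * ?a powr (- p - 1 - 1) * ?g) * ?g + ?h * (\<beta> * p * ?a powr (- p - 1)))
      - partial_deriv i (partial_deriv i (laplacian u)) ?z = defect_second_partial \<alpha> \<beta> p u i ?z"
      unfolding 1 defect_second_partial_def
      by (simp add: algebra_simps power2_eq_square)
  qed
qed

section \<open>The differential inequality\<close>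

text \<open>The algebra at a maximum point, written with the scalars that occur there. With \<open>g = \<nabla>u\<close>,
  \<open>H = D\<^sup>2u\<close> and \<open>\<tau>\<close> the logarithmic gradient of the cutoff part of the barrier, they are \<open>w\<close> the
  defect, \<open>G = |g|\<^sup>2 / u\<close>, \<open>B = u powr (- p)\<close>, \<open>v = \<Delta>u\<close>, \<open>HH = |H|\<^sup>2\<close>,
  \<open>S = (H g \<bullet> g) / u\<close>, \<open>T = g \<bullet> \<nabla>v\<close>, \<open>X = g \<bullet> \<tau>\<close>, \<open>N = u |\<tau>|\<^sup>2\<close>,
  \<open>L = u\<close> times the divergence of \<open>\<tau>\<close>, and \<open>\<kappa> = 1 / n\<close>. The hypothesis \<open>first\<close> is the first order
  condition tested with \<open>g\<close>, and \<open>second\<close> compares the Laplacians of defect and barrier.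

  Eliminating \<open>T\<close> by \<open>first\<close> and \<open>HH\<close> by \<open>hessian\<close>, and then \<open>v\<close>, leaves on the left of
  \<open>second\<close> a multiple of \<open>w\<close> plus a quadratic form in \<open>G\<close> and \<open>B\<close> whose three coefficients are
  nonnegative. After division by \<open>w\<close> the choice of \<open>\<theta>\<close> maximizes the surplus
  \<open>\<theta> (1 - 3 \<alpha>) - \<theta>\<^sup>2\<close> of \<open>G\<close>, with maximum \<open>\<theta>\<^sup>2\<close>.\<close>

lemma touching_point_scalar_inequality:
  fixes \<alpha> \<beta> p \<kappa> \<theta> :: real
  assumes w: "w > 0" and B: "B > 0" and G: "G \<ge> 0"
    and \<alpha>: "0 \<le> \<alpha>" "\<alpha> < 1 / 3" and \<beta>: "\<beta> > 0" and \<kappa>: "\<kappa> \<ge> 0"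
    and \<theta>: "\<theta> = (1 - 3 * \<alpha>) / 2"
    and p: "p \<ge> 1 + 4 * \<alpha> * \<kappa>"
    and mixed: "p\<^sup>2 + p * (1 - 3 * \<alpha>) - \<alpha> - 4 * \<alpha> * (1 - 2 * \<alpha>) * \<kappa> \<ge> 0"
    and \<beta>2: "\<beta>\<^sup>2 * (p - 2 * \<alpha> * \<kappa>) \<le> 1"
    and first: "\<alpha> * (2 * S - G\<^sup>2) - \<beta> * p * B * G - T = w * (\<theta> * G + X)"
    and second: "\<alpha> * (2 * HH + 2 * T - 4 * S - G * v + 2 * G\<^sup>2) - \<beta> * p * (B * v - (p + 1) * B * G) + B\<^sup>2
      \<le> w * (\<theta>\<^sup>2 * G + 2 * \<theta> * X + N + \<theta> * v - \<theta> * G + L)"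
    and hessian: "\<kappa> * (v - (1 - \<alpha>) * G)\<^sup>2 \<le> HH - 2 * (1 - \<alpha>) * S + (1 - \<alpha>)\<^sup>2 * G\<^sup>2"
    and v: "v = \<alpha> * G + \<beta> * B - w"
  shows "\<theta> * w + \<theta>\<^sup>2 * G \<le> 2 * (\<alpha> + \<theta>) * X + N + L"
proof -
  have T: "T = \<alpha> * (2 * S - G\<^sup>2) - \<beta> * p * B * G - w * (\<theta> * G + X)" using first by simp
  have "2 * \<alpha> * (\<kappa> * (v - (1 - \<alpha>) * G)\<^sup>2) \<le> 2 * \<alpha> * (HH - 2 * (1 - \<alpha>) * S + (1 - \<alpha>)\<^sup>2 * G\<^sup>2)"
    using hessian \<alpha> by (intro mult_left_mono) auto
  with second have "2 * \<alpha> * (\<kappa> * (v - (1 - \<alpha>) * G)\<^sup>2) + 2 * \<alpha>\<^sup>2 * (1 - \<alpha>) * G\<^sup>2 - \<alpha> * G * v - \<beta> * p * B * v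
      + \<beta> * p * (p + 1 - 2 * \<alpha>) * B * G + B\<^sup>2
    \<le> w * (\<theta>\<^sup>2 * G + 2 * (\<theta> + \<alpha>) * X + 2 * \<alpha> * \<theta> * G + N + \<theta> * v - \<theta> * G + L)"
    unfolding T by (simp add: algebra_simps power2_eq_square)
  moreover have "2 * \<alpha> * (\<kappa> * (v - (1 - \<alpha>) * G)\<^sup>2) + 2 * \<alpha>\<^sup>2 * (1 - \<alpha>) * G\<^sup>2 - \<alpha> * G * v - \<beta> * p * B * v
      + \<beta> * p * (p + 1 - 2 * \<alpha>) * B * G + B\<^sup>2
    = w * (2 * \<alpha> * \<kappa> * w + (\<alpha> + 4 * \<alpha> * (1 - 2 * \<alpha>) * \<kappa>) * G + \<beta> * (p - 4 * \<alpha> * \<kappa>) * B)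
      + \<alpha> * (1 - 2 * \<alpha>) * (2 * (1 - 2 * \<alpha>) * \<kappa> + \<alpha>) * G\<^sup>2
      + \<beta> * (p\<^sup>2 + p * (1 - 3 * \<alpha>) - \<alpha> - 4 * \<alpha> * (1 - 2 * \<alpha>) * \<kappa>) * (G * B)
      + (1 - \<beta>\<^sup>2 * (p - 2 * \<alpha> * \<kappa>)) * B\<^sup>2"
    unfolding v by (simp add: algebra_simps power2_eq_square)
  moreover have "\<alpha> * (1 - 2 * \<alpha>) * (2 * (1 - 2 * \<alpha>) * \<kappa> + \<alpha>) * G\<^sup>2 \<ge> 0"
    using \<alpha> \<kappa> by (intro mult_nonneg_nonneg add_nonneg_nonneg) auto
  moreover have "\<beta> * (p\<^sup>2 + p * (1 - 3 * \<alpha>) - \<alpha> - 4 * \<alpha> * (1 - 2 * \<alpha>) * \<kappa>) * (G * B) \<ge> 0"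
    using mixed \<beta> G B by (intro mult_nonneg_nonneg) auto
  moreover have "(1 - \<beta>\<^sup>2 * (p - 2 * \<alpha> * \<kappa>)) * B\<^sup>2 \<ge> 0"
    using \<beta>2 by (intro mult_nonneg_nonneg) auto
  ultimately have "w * (2 * \<alpha> * \<kappa> * w + (\<alpha> + 4 * \<alpha> * (1 - 2 * \<alpha>) * \<kappa>) * G + \<beta> * (p - 4 * \<alpha> * \<kappa>) * B)
    \<le> w * (\<theta>\<^sup>2 * G + 2 * (\<theta> + \<alpha>) * X + 2 * \<alpha> * \<theta> * G + N + \<theta> * v - \<theta> * G + L)"
    by linarith
  then have "2 * \<alpha> * \<kappa> * w + (\<alpha> + 4 * \<alpha> * (1 - 2 * \<alpha>) * \<kappa>) * G + \<beta> * (p - 4 * \<alpha> * \<kappa>) * B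
    \<le> \<theta>\<^sup>2 * G + 2 * (\<theta> + \<alpha>) * X + 2 * \<alpha> * \<theta> * G + N + \<theta> * v - \<theta> * G + L"
    using w by simp
  then have "2 * \<alpha> * \<kappa> * w + (\<alpha> + 4 * \<alpha> * (1 - 2 * \<alpha>) * \<kappa>) * G + \<beta> * (p - 4 * \<alpha> * \<kappa> - \<theta>) * B
      + \<theta> * w + (\<theta> * (1 - 3 * \<alpha>) - \<theta>\<^sup>2) * G
    \<le> 2 * (\<alpha> + \<theta>) * X + N + L"
    unfolding v by (simp add: algebra_simps power2_eq_square)
  moreover have "\<theta> * (1 - 3 * \<alpha>) - \<theta>\<^sup>2 = \<theta>\<^sup>2"
    unfolding \<theta> by (simp add: power2_eq_square field_simps)
  moreover have "2 * \<alpha> * \<kappa> * w \<ge> 0" using \<alpha> \<kappa> w by simp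
  moreover have "(\<alpha> + 4 * \<alpha> * (1 - 2 * \<alpha>) * \<kappa>) * G \<ge> 0"
    using \<alpha> \<kappa> G by (intro mult_nonneg_nonneg add_nonneg_nonneg) auto
  moreover have "\<beta> * (p - 4 * \<alpha> * \<kappa> - \<theta>) * B \<ge> 0"
    using \<alpha> \<beta> B p \<theta> by (intro mult_nonneg_nonneg) auto
  ultimately show ?thesis by (smt (verit))
qed

text \<open>The right-hand side is the square of the Frobenius norm of \<open>H - c g g\<^sup>T\<close>; the inequality is
  Cauchy-Schwarz for the diagonal of this matrix.\<close>

lemma hessian_trace_inequality:
  fixes H :: "'n::finite \<Rightarrow> 'n \<Rightarrow> real" and g :: "'n \<Rightarrow> real"
  shows "((\<Sum>i\<in>UNIV. H i i) - c * (\<Sum>i\<in>UNIV. (g i)\<^sup>2))\<^sup>2 / real CARD('n)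
    \<le> (\<Sum>i\<in>UNIV. \<Sum>j\<in>UNIV. (H i j)\<^sup>2) - 2 * c * (\<Sum>i\<in>UNIV. \<Sum>j\<in>UNIV. g i * g j * H i j)
      + c\<^sup>2 * (\<Sum>i\<in>UNIV. (g i)\<^sup>2)\<^sup>2"
proof -
  have "((\<Sum>i\<in>UNIV. H i i) - c * (\<Sum>i\<in>UNIV. (g i)\<^sup>2))\<^sup>2 = (\<Sum>i\<in>UNIV. (H i i - c * (g i * g i)) * 1)\<^sup>2"
    by (simp add: sum_subtractf sum_distrib_left power2_eq_square)
  also have "\<dots> \<le> (\<Sum>i\<in>UNIV. (H i i - c * (g i * g i))\<^sup>2) * (\<Sum>i\<in>(UNIV :: 'n set). 1\<^sup>2)"
    by (rule Cauchy_Schwarz_ineq_sum)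
  finally have "((\<Sum>i\<in>UNIV. H i i) - c * (\<Sum>i\<in>UNIV. (g i)\<^sup>2))\<^sup>2 / real CARD('n)
      \<le> (\<Sum>i\<in>UNIV. (H i i - c * (g i * g i))\<^sup>2)"
    by (simp add: divide_le_eq)
  also have "\<dots> \<le> (\<Sum>i\<in>UNIV. \<Sum>j\<in>UNIV. (H i j - c * (g i * g j))\<^sup>2)"
  proof (rule sum_mono)
    fix i :: 'n
    show "(H i i - c * (g i * g i))\<^sup>2 \<le> (\<Sum>j\<in>UNIV. (H i j - c * (g i * g j))\<^sup>2)"
      by (rule member_le_sum[of i UNIV "\<lambda>j. (H i j - c * (g i * g j))\<^sup>2"]) auto
  qed
  also have "\<dots> = (\<Sum>i\<in>UNIV. \<Sum>j\<in>UNIV. (H i j)\<^sup>2 - 2 * c * (g i * g j * H i j) + c\<^sup>2 * ((g i)\<^sup>2 * (g j)\<^sup>2))"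
    by (intro sum.cong refl) (simp add: power2_eq_square algebra_simps)
  also have "\<dots> = (\<Sum>i\<in>UNIV. \<Sum>j\<in>UNIV. (H i j)\<^sup>2) - 2 * c * (\<Sum>i\<in>UNIV. \<Sum>j\<in>UNIV. g i * g j * H i j)
      + c\<^sup>2 * (\<Sum>i\<in>UNIV. \<Sum>j\<in>UNIV. (g i)\<^sup>2 * (g j)\<^sup>2)"
    by (simp add: sum.distrib sum_subtractf sum_distrib_left)
  also have "(\<Sum>i\<in>UNIV. \<Sum>j\<in>UNIV. (g i)\<^sup>2 * (g j)\<^sup>2) = (\<Sum>i\<in>UNIV. (g i)\<^sup>2)\<^sup>2"
    by (simp add: power2_eq_square sum_product)
  finally show ?thesis .
qed



section \<open>Touching the defect by a barrier\<close>

text \<open>The level-\<open>M\<close> comparison function: the defect lies below \<open>barrier M\<close> in the ball exactly when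
  \<open>w u powr (- \<theta>) (R\<^sup>2 - |z - y|\<^sup>2)\<^sup>2\<close> is at most \<open>M\<close> there. The two definitions that follow are its
  first logarithmic partial derivatives and their own derivatives along the same axis.\<close>

definition barrier ::
  "real \<Rightarrow> real \<Rightarrow> (real ^ 'n \<Rightarrow> real) \<Rightarrow> real ^ 'n \<Rightarrow> real \<Rightarrow> real ^ 'n \<Rightarrow> real" where
  "barrier M \<theta> u y R z = M * u z powr \<theta> / (R\<^sup>2 - (norm (z - y))\<^sup>2)\<^sup>2"

definition barrier_log_partial ::
  "real \<Rightarrow> (real ^ 'n \<Rightarrow> real) \<Rightarrow> real ^ 'n \<Rightarrow> real \<Rightarrow> 'n \<Rightarrow> real ^ 'n \<Rightarrow> real" where
  "barrier_log_partial \<theta> u y R i z =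
     \<theta> * partial_deriv i u z / u z + 4 * (z - y) $ i / (R\<^sup>2 - (norm (z - y))\<^sup>2)"

definition barrier_log_second_partial ::
  "real \<Rightarrow> (real ^ 'n \<Rightarrow> real) \<Rightarrow> real ^ 'n \<Rightarrow> real \<Rightarrow> 'n \<Rightarrow> real ^ 'n \<Rightarrow> real" where
  "barrier_log_second_partial \<theta> u y R i z =
     \<theta> * (partial_deriv i (partial_deriv i u) z / u z - (partial_deriv i u z)\<^sup>2 / (u z)\<^sup>2)
     + (4 / (R\<^sup>2 - (norm (z - y))\<^sup>2) + 8 * ((z - y) $ i)\<^sup>2 / (R\<^sup>2 - (norm (z - y))\<^sup>2)\<^sup>2)"

lemma barrier_along_axis:
  fixes u :: "real ^ 'n \<Rightarrow> real"
  assumes u: "C_k 2 u" and pos: "\<And>z. u z > 0"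
    and \<rho>: "R\<^sup>2 - (norm (x + s *\<^sub>R axis i 1 - y))\<^sup>2 \<noteq> 0"
  shows "((\<lambda>s. barrier M \<theta> u y R (x + s *\<^sub>R axis i 1)) has_real_derivative
      barrier M \<theta> u y R (x + s *\<^sub>R axis i 1) * barrier_log_partial \<theta> u y R i (x + s *\<^sub>R axis i 1)) (at s)"
      (is ?first)
    and "((\<lambda>s. barrier_log_partial \<theta> u y R i (x + s *\<^sub>R axis i 1)) has_real_derivative
      barrier_log_second_partial \<theta> u y R i (x + s *\<^sub>R axis i 1)) (at s)" (is ?second)
proof -
  define e where "e = (axis i 1 :: real ^ 'n)"
  define z where "z = x + s *\<^sub>R e"
  define \<rho> where "\<rho> s = R\<^sup>2 - (norm (x + s *\<^sub>R e - y))\<^sup>2" for s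
  have \<rho>0: "\<rho> s \<noteq> 0" using assms(3) by (simp add: \<rho>_def e_def)
  have du: "u differentiable (at z)" "partial_deriv j u differentiable (at z)" for j z
    using u by (auto simp: eval_nat_numeral)
  note line = partial_deriv_along_axis[where i = i and x = x, folded e_def]
  note a = line[OF du(1), of s, folded z_def] and b = line[OF du(2), of i s, folded z_def]
  have c: "((\<lambda>s. (x + s *\<^sub>R e - y) $ i) has_real_derivative 1) (at s)"
    by (auto simp: e_def axis_def intro!: derivative_eq_intros)
  have n: "\<rho> s = R\<^sup>2 - ((norm (x - y))\<^sup>2 + 2 * s * (x - y) $ i + s\<^sup>2)" for s
  proof -
    have "(norm ((x - y) + s *\<^sub>R e))\<^sup>2 = (norm (x - y))\<^sup>2 + 2 * s * (x - y) $ i + s\<^sup>2"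
      unfolding power2_norm_eq_inner e_def
      by (simp add: inner_add_left inner_add_right inner_axis inner_axis' power2_eq_square algebra_simps)
    moreover have "x + s *\<^sub>R e - y = (x - y) + s *\<^sub>R e" by simp
    ultimately show ?thesis unfolding \<rho>_def by presburger
  qed
  have r: "(\<rho> has_real_derivative - 2 * (z - y) $ i) (at s)"
    unfolding n[abs_def] z_def e_def by (auto intro!: derivative_eq_intros)
  have r2: "((\<lambda>s. (\<rho> s)\<^sup>2) has_real_derivative 2 * \<rho> s * (- 2 * (z - y) $ i)) (at s)"
    by (rule derivative_eq_intros r | simp)+
  have zs: "x + s *\<^sub>R e = z" by (simp add: z_def)
  have powr: "((\<lambda>s. u (x + s *\<^sub>R e) powr \<theta>) has_real_derivative
      \<theta> * u z powr (\<theta> - 1) * partial_deriv i u z) (at s)"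
  proof -
    have "((\<lambda>t. t powr \<theta>) has_real_derivative \<theta> * u (x + s *\<^sub>R e) powr (\<theta> - 1)) (at (u (x + s *\<^sub>R e)))"
      by (rule has_real_derivative_powr[OF pos])
    from DERIV_chain'[OF a this] show ?thesis by (simp add: zs mult.commute)
  qed
  have ne: "u z \<noteq> 0" using pos[of z] by simp
  have "u z powr (\<theta> - 1) = u z powr \<theta> / u z" using pos[of z] by (simp add: powr_diff)
  with powr have powr: "((\<lambda>s. u (x + s *\<^sub>R e) powr \<theta>) has_real_derivative
      partial_deriv i u z * (\<theta> * (u z powr \<theta> / u z))) (at s)" by (simp add: mult_ac)
  have "((\<lambda>s. M * u (x + s *\<^sub>R e) powr \<theta> / (\<rho> s)\<^sup>2) has_real_derivative
      M * u z powr \<theta> / (\<rho> s)\<^sup>2 * (\<theta> * partial_deriv i u z / u z + 4 * (z - y) $ i / \<rho> s)) (at s)"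
  proof (rule DERIV_cong[OF DERIV_divide[OF DERIV_cmult[OF powr] r2]])
    have *: "(M * (g * (\<theta> * (P / a))) * r\<^sup>2 - M * P * (2 * r * (- 2 * d))) / (r\<^sup>2 * r\<^sup>2)
      = M * P / r\<^sup>2 * (\<theta> * g / a + 4 * d / r)" if "a \<noteq> 0" "r \<noteq> 0" for g P a r d :: real
      using that by (simp add: divide_simps) (simp add: algebra_simps eval_nat_numeral)
    show "(M * (partial_deriv i u z * (\<theta> * (u z powr \<theta> / u z))) * (\<rho> s)\<^sup>2
        - M * u (x + s *\<^sub>R e) powr \<theta> * (2 * \<rho> s * (- 2 * (z - y) $ i))) / ((\<rho> s)\<^sup>2 * (\<rho> s)\<^sup>2)
      = M * u z powr \<theta> / (\<rho> s)\<^sup>2 * (\<theta> * partial_deriv i u z / u z + 4 * (z - y) $ i / \<rho> s)"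
      unfolding zs by (rule *[OF ne \<rho>0])
  qed (use \<rho>0 in auto)
  then show ?first
    unfolding barrier_def barrier_log_partial_def \<rho>_def z_def e_def .
  have "((\<lambda>s. \<theta> * partial_deriv i u (x + s *\<^sub>R e) / u (x + s *\<^sub>R e) + 4 * (x + s *\<^sub>R e - y) $ i / \<rho> s)
      has_real_derivative \<theta> * (partial_deriv i (partial_deriv i u) z / u z - (partial_deriv i u z)\<^sup>2 / (u z)\<^sup>2)
     + (4 / \<rho> s + 8 * ((z - y) $ i)\<^sup>2 / (\<rho> s)\<^sup>2)) (at s)"
  proof (rule DERIV_cong[OF DERIV_add[OF DERIV_divide[OF DERIV_cmult[OF b] a] DERIV_divide[OF DERIV_cmult[OF c] r]]])
    have *: "(\<theta> * h * a - \<theta> * g * g) / (a * a) + (4 * 1 * r - 4 * d * (- 2 * d)) / (r * r)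
      = \<theta> * (h / a - g\<^sup>2 / a\<^sup>2) + (4 / r + 8 * d\<^sup>2 / r\<^sup>2)" if "a \<noteq> 0" "r \<noteq> 0" for h a g r d :: real
      using that by (simp add: divide_simps) (simp add: algebra_simps eval_nat_numeral)
    show "(\<theta> * partial_deriv i (partial_deriv i u) z * u (x + s *\<^sub>R e)
        - \<theta> * partial_deriv i u (x + s *\<^sub>R e) * partial_deriv i u z) / (u (x + s *\<^sub>R e) * u (x + s *\<^sub>R e))
        + (4 * 1 * \<rho> s - 4 * (x + s *\<^sub>R e - y) $ i * (- 2 * (z - y) $ i)) / (\<rho> s * \<rho> s)
      = \<theta> * (partial_deriv i (partial_deriv i u) z / u z - (partial_deriv i u z)\<^sup>2 / (u z)\<^sup>2)
     + (4 / \<rho> s + 8 * ((z - y) $ i)\<^sup>2 / (\<rho> s)\<^sup>2)"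
      unfolding zs by (rule *[OF ne \<rho>0])
  qed (use ne \<rho>0 in \<open>auto simp: zs\<close>)
  then show ?second
    unfolding barrier_log_second_partial_def barrier_log_partial_def \<rho>_def z_def e_def .
qed

text \<open>Defect minus barrier has a local maximum at a touching point, so its first partial derivatives vanish
  and its pure second partial derivatives are nonpositive there. As the two functions agree at that point,
  the derivatives of the barrier are expressed through the defect.\<close>

lemma touching_point_derivatives:
  fixes u :: "real ^ 'n \<Rightarrow> real"
  assumes u: "C_k 4 u" and pos: "\<And>z. u z > 0"
    and x: "x \<in> ball y R"
    and below: "\<And>z. z \<in> ball y R \<Longrightarrow> defect \<alpha> \<beta> p u z \<le> barrier M \<theta> u y R z"
    and touch: "defect \<alpha> \<beta> p u x = barrier M \<theta> u y R x"
  shows "defect_partial \<alpha> \<beta> p u i x = defect \<alpha> \<beta> p u x * barrier_log_partial \<theta> u y R i x"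
    and "defect_second_partial \<alpha> \<beta> p u i x
      \<le> defect \<alpha> \<beta> p u x * ((barrier_log_partial \<theta> u y R i x)\<^sup>2 + barrier_log_second_partial \<theta> u y R i x)"
proof -
  have u2: "C_k 2 u" using C_k_mono[OF u] by simp
  define d where "d = R - dist y x"
  have d: "d > 0" using x by (simp add: d_def)
  have ball: "x + s *\<^sub>R axis i 1 \<in> ball y R" if "\<bar>s\<bar> < d" for s
  proof -
    have "dist y (x + s *\<^sub>R axis i 1) \<le> dist y x + dist x (x + s *\<^sub>R axis i 1)"
      by (rule dist_triangle)
    also have "dist x (x + s *\<^sub>R axis i (1::real)) = \<bar>s\<bar>"
      by (simp add: dist_norm norm_axis_1)
    finally show ?thesis using that by (simp add: d_def)
  qed
  have \<rho>: "R\<^sup>2 - (norm (z - y))\<^sup>2 \<noteq> 0" if "z \<in> ball y R" for z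
  proof -
    have "norm (z - y) < R" using that by (simp add: dist_norm norm_minus_commute)
    then have "(norm (z - y))\<^sup>2 < R\<^sup>2" by (intro power_strict_mono) auto
    then show ?thesis by simp
  qed
  let ?z = "\<lambda>s. x + s *\<^sub>R axis i 1"
  let ?f = "\<lambda>s. defect \<alpha> \<beta> p u (?z s) - barrier M \<theta> u y R (?z s)"
  let ?f' = "\<lambda>s. defect_partial \<alpha> \<beta> p u i (?z s) - barrier M \<theta> u y R (?z s) * barrier_log_partial \<theta> u y R i (?z s)"
  have 1: "DERIV ?f s :> ?f' s" if "\<bar>s\<bar> < d" for s
    by (intro DERIV_diff defect_along_axis(1)[OF u pos] barrier_along_axis(1)[OF u2 pos] \<rho> ball that)
  have 2: "DERIV ?f' 0 :> defect_second_partial \<alpha> \<beta> p u i (?z 0)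
    - (barrier M \<theta> u y R (?z 0) * barrier_log_partial \<theta> u y R i (?z 0) * barrier_log_partial \<theta> u y R i (?z 0)
     + barrier_log_second_partial \<theta> u y R i (?z 0) * barrier M \<theta> u y R (?z 0))"
    by (intro DERIV_diff DERIV_mult defect_along_axis(2)[OF u pos] barrier_along_axis[OF u2 pos] \<rho> ball)
      (simp_all add: d)
  have 3: "?f s \<le> ?f 0" if "\<bar>s\<bar> < d" for s
    using below[OF ball[OF that]] touch by simp
  note test = second_derivative_test_local_max[OF d 1 2 3]
  show "defect_partial \<alpha> \<beta> p u i x = defect \<alpha> \<beta> p u x * barrier_log_partial \<theta> u y R i x"
    using test(1) touch by simp
  show "defect_second_partial \<alpha> \<beta> p u i x
      \<le> defect \<alpha> \<beta> p u x * ((barrier_log_partial \<theta> u y R i x)\<^sup>2 + barrier_log_second_partial \<theta> u y R i x)"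
    using test(2) touch by (simp add: algebra_simps power2_eq_square)
qed

text \<open>Summing the conditions at a touching point over all axes yields the scalars of
  \<open>touching_point_scalar_inequality\<close>. The cross term is absorbed by \<open>\<theta>\<^sup>2 G\<close> through Young's
  inequality, and the cutoff terms are bounded by \<open>R\<^sup>2 / (R\<^sup>2 - |x - y|\<^sup>2)\<^sup>2\<close>.\<close>

lemma touching_point_bound:
  fixes u :: "real ^ 'n \<Rightarrow> real" and \<alpha> \<beta> p \<theta> :: real
  assumes u: "C_k 4 u" and pos: "\<And>z. u z > 0"
    and eq: "\<And>z. - bilaplacian u z = u z powr (- (2 * p + 1))"
    and \<alpha>: "0 \<le> \<alpha>" "\<alpha> < 1 / 3" and \<beta>: "\<beta> > 0"
    and \<theta>: "\<theta> = (1 - 3 * \<alpha>) / 2"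
    and p: "p \<ge> 1 + 4 * \<alpha> / real CARD('n)"
    and mixed: "p\<^sup>2 + p * (1 - 3 * \<alpha>) - \<alpha> - 4 * \<alpha> * (1 - 2 * \<alpha>) / real CARD('n) \<ge> 0"
    and \<beta>2: "\<beta>\<^sup>2 * (p - 2 * \<alpha> / real CARD('n)) \<le> 1"
    and x: "x \<in> ball y R"
    and below: "\<And>z. z \<in> ball y R \<Longrightarrow> defect \<alpha> \<beta> p u z \<le> barrier M \<theta> u y R z"
    and touch: "defect \<alpha> \<beta> p u x = barrier M \<theta> u y R x"
    and w: "defect \<alpha> \<beta> p u x > 0"
  shows "\<theta> * defect \<alpha> \<beta> p u x * (R\<^sup>2 - (norm (x - y))\<^sup>2)\<^sup>2
    \<le> (16 * (\<alpha> + \<theta>)\<^sup>2 / \<theta>\<^sup>2 + 24 + 4 * real CARD('n)) * u x * R\<^sup>2"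
proof -
  have u3: "C_k 3 u" using C_k_mono[OF u] by simp
  define n where "n = real CARD('n)"
  have n: "n > 0" by (simp add: n_def)
  define a where "a = u x"
  have a: "a > 0" using pos by (simp add: a_def)
  define W where "W = defect \<alpha> \<beta> p u x"
  define g where "g i = partial_deriv i u x" for i
  define H where "H i j = partial_deriv i (partial_deriv j u) x" for i j
  define K where "K i j = partial_deriv i (partial_deriv i (partial_deriv j u)) x" for i j
  define V where "V i = partial_deriv i (laplacian u) x" for i
  define \<rho> where "\<rho> = R\<^sup>2 - (norm (x - y))\<^sup>2"
  define \<tau> where "\<tau> i = 4 * (x - y) $ i / \<rho>" for i
  define l where "l i = 4 / \<rho> + 8 * ((x - y) $ i)\<^sup>2 / \<rho>\<^sup>2" for i
  define B where "B = a powr (- p)"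
  define \<Gamma> where "\<Gamma> = (\<Sum>i\<in>UNIV. (g i)\<^sup>2)"
  define Q where "Q = (\<Sum>i\<in>UNIV. \<Sum>j\<in>UNIV. g i * g j * H i j)"
  define HH where "HH = (\<Sum>i\<in>UNIV. \<Sum>j\<in>UNIV. (H i j)\<^sup>2)"
  define v where "v = (\<Sum>i\<in>UNIV. H i i)"
  define T where "T = (\<Sum>i\<in>UNIV. g i * V i)"
  define X where "X = (\<Sum>i\<in>UNIV. g i * \<tau> i)"
  define N where "N = (\<Sum>i\<in>UNIV. (\<tau> i)\<^sup>2)"
  define L where "L = (\<Sum>i\<in>UNIV. l i)"
  have B: "B > 0" using a by (simp add: B_def)
  have powers: "a powr (- p - 1) = B / a" "a powr (- p - 2) = B / a\<^sup>2" "a powr (- (2 * p + 1)) = B\<^sup>2 / a"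
  proof -
    show "a powr (- p - 1) = B / a" "a powr (- p - 2) = B / a\<^sup>2"
      using a by (simp_all add: B_def powr_diff)
    have "a powr (- (2 * p + 1)) = a powr (- p + - p - 1)" by (rule arg_cong[where f = "\<lambda>r. a powr r"]) simp
    also have "\<dots> = B\<^sup>2 / a" using a unfolding powr_diff powr_add B_def by (simp add: power2_eq_square)
    finally show "a powr (- (2 * p + 1)) = B\<^sup>2 / a" .
  qed
  note touching = touching_point_derivatives[OF u pos x below touch]
  have first_i: "\<alpha> * (2 * (\<Sum>j\<in>UNIV. g j * H i j) / a - \<Gamma> * g i / a\<^sup>2) - \<beta> * p * (B / a) * g i - V i
      = W * (\<theta> * g i / a + \<tau> i)" for i
    using touching(1)[of i] unfolding defect_partial_def barrier_log_partial_def
    by (simp only: W_def g_def H_def V_def \<Gamma>_def \<tau>_def \<rho>_def a_def powers(1)[unfolded a_def, symmetric])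
  have second_i: "\<alpha> * (2 * (\<Sum>j\<in>UNIV. (H i j)\<^sup>2 + g j * K i j) / a
        - 4 * (\<Sum>j\<in>UNIV. g j * H i j) * g i / a\<^sup>2 - \<Gamma> * H i i / a\<^sup>2 + 2 * \<Gamma> * (g i)\<^sup>2 / a ^ 3)
      - \<beta> * p * ((B / a) * H i i - (p + 1) * (B / a\<^sup>2) * (g i)\<^sup>2)
      - partial_deriv i (partial_deriv i (laplacian u)) x
      \<le> W * ((\<theta> * g i / a + \<tau> i)\<^sup>2 + (\<theta> * (H i i / a - (g i)\<^sup>2 / a\<^sup>2) + l i))" for i
    using touching(2)[of i] unfolding defect_second_partial_def barrier_log_partial_def barrier_log_second_partial_def
    by (simp only: W_def g_def H_def K_def \<Gamma>_def \<tau>_def \<rho>_def l_def a_def powers(1,2)[unfolded a_def, symmetric])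
  have gsum: "(\<Sum>i\<in>UNIV. g i * (\<Sum>j\<in>UNIV. g j * H i j)) = Q"
    unfolding Q_def by (simp add: sum_distrib_left mult.assoc)
  have first: "\<alpha> * (2 * (Q / a) - (\<Gamma> / a)\<^sup>2) - \<beta> * p * B * (\<Gamma> / a) - T = W * (\<theta> * (\<Gamma> / a) + X)"
  proof -
    have "(\<Sum>i\<in>UNIV. g i * (\<alpha> * (2 * (\<Sum>j\<in>UNIV. g j * H i j) / a - \<Gamma> * g i / a\<^sup>2) - \<beta> * p * (B / a) * g i - V i))
        = (\<Sum>i\<in>UNIV. (2 * \<alpha> / a) * (g i * (\<Sum>j\<in>UNIV. g j * H i j)) - (\<alpha> * \<Gamma> / a\<^sup>2) * (g i)\<^sup>2
            - (\<beta> * p * B / a) * (g i)\<^sup>2 - g i * V i)"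
      by (intro sum.cong refl) (simp add: algebra_simps power2_eq_square)
    also have "\<dots> = (2 * \<alpha> / a) * Q - (\<alpha> * \<Gamma> / a\<^sup>2) * \<Gamma> - (\<beta> * p * B / a) * \<Gamma> - T"
      by (simp only: sum_subtractf sum_distrib_left[symmetric] gsum \<Gamma>_def T_def)
    also have "\<dots> = \<alpha> * (2 * (Q / a) - (\<Gamma> / a)\<^sup>2) - \<beta> * p * B * (\<Gamma> / a) - T"
      by (simp add: algebra_simps power2_eq_square)
    finally have l: "(\<Sum>i\<in>UNIV. g i * (\<alpha> * (2 * (\<Sum>j\<in>UNIV. g j * H i j) / a - \<Gamma> * g i / a\<^sup>2) - \<beta> * p * (B / a) * g i - V i))
        = \<alpha> * (2 * (Q / a) - (\<Gamma> / a)\<^sup>2) - \<beta> * p * B * (\<Gamma> / a) - T" .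
    have "(\<Sum>i\<in>UNIV. g i * (W * (\<theta> * g i / a + \<tau> i)))
        = (\<Sum>i\<in>UNIV. (W * \<theta> / a) * (g i)\<^sup>2 + W * (g i * \<tau> i))"
      by (intro sum.cong refl) (simp add: algebra_simps power2_eq_square)
    also have "\<dots> = (W * \<theta> / a) * \<Gamma> + W * X"
      by (simp only: sum.distrib sum_distrib_left[symmetric] \<Gamma>_def X_def)
    also have "\<dots> = W * (\<theta> * (\<Gamma> / a) + X)" by (simp add: algebra_simps)
    finally show ?thesis using l by (simp only: first_i)
  qed
  \<comment> \<open>The third derivatives of \<open>u\<close> sum to the gradient of \<open>\<Delta>u\<close>, and the fourth to the right-hand side of the equation.\<close>
  have third: "(\<Sum>i\<in>UNIV. K i j) = V j" for j
    using laplacian_partial_deriv[OF u3, of j x] by (simp add: K_def V_def laplacian_def)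
  have gK: "(\<Sum>i\<in>UNIV. \<Sum>j\<in>UNIV. g j * K i j) = T"
  proof -
    have "(\<Sum>i\<in>UNIV. \<Sum>j\<in>UNIV. g j * K i j) = (\<Sum>j\<in>UNIV. \<Sum>i\<in>UNIV. g j * K i j)"
      by (rule sum.swap)
    also have "\<dots> = T" by (simp only: sum_distrib_left[symmetric] third T_def)
    finally show ?thesis .
  qed
  have fourth: "(\<Sum>i\<in>UNIV. partial_deriv i (partial_deriv i (laplacian u)) x) = - (B\<^sup>2 / a)"
    using eq[of x] powers(3) by (simp add: bilaplacian_def laplacian_def[of "laplacian u"] a_def)
  have second: "\<alpha> * (2 * HH + 2 * T - 4 * (Q / a) - (\<Gamma> / a) * v + 2 * (\<Gamma> / a)\<^sup>2)
      - \<beta> * p * (B * v - (p + 1) * B * (\<Gamma> / a)) + B\<^sup>2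
      \<le> W * (\<theta>\<^sup>2 * (\<Gamma> / a) + 2 * \<theta> * X + a * N + \<theta> * v - \<theta> * (\<Gamma> / a) + a * L)"
  proof -
    let ?lhs = "\<lambda>i. \<alpha> * (2 * (\<Sum>j\<in>UNIV. (H i j)\<^sup>2 + g j * K i j) / a
        - 4 * (\<Sum>j\<in>UNIV. g j * H i j) * g i / a\<^sup>2 - \<Gamma> * H i i / a\<^sup>2 + 2 * \<Gamma> * (g i)\<^sup>2 / a ^ 3)
      - \<beta> * p * ((B / a) * H i i - (p + 1) * (B / a\<^sup>2) * (g i)\<^sup>2)
      - partial_deriv i (partial_deriv i (laplacian u)) x"
    let ?rhs = "\<lambda>i. W * ((\<theta> * g i / a + \<tau> i)\<^sup>2 + (\<theta> * (H i i / a - (g i)\<^sup>2 / a\<^sup>2) + l i))"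
    have le: "a * (\<Sum>i\<in>UNIV. ?lhs i) \<le> a * (\<Sum>i\<in>UNIV. ?rhs i)"
      using a by (intro mult_left_mono sum_mono second_i) auto
    have "(\<Sum>i\<in>UNIV. ?lhs i) = (\<Sum>i\<in>UNIV. (2 * \<alpha> / a) * (\<Sum>j\<in>UNIV. (H i j)\<^sup>2) + (2 * \<alpha> / a) * (\<Sum>j\<in>UNIV. g j * K i j)
        - (4 * \<alpha> / a\<^sup>2) * (g i * (\<Sum>j\<in>UNIV. g j * H i j)) - (\<alpha> * \<Gamma> / a\<^sup>2) * H i i
        + (2 * \<alpha> * \<Gamma> / a ^ 3) * (g i)\<^sup>2 - (\<beta> * p * B / a) * H i i + (\<beta> * p * (p + 1) * B / a\<^sup>2) * (g i)\<^sup>2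
        - partial_deriv i (partial_deriv i (laplacian u)) x)"
      by (intro sum.cong refl) (simp add: sum.distrib add_divide_distrib diff_divide_distrib algebra_simps)
    also have "\<dots> = (2 * \<alpha> / a) * HH + (2 * \<alpha> / a) * T - (4 * \<alpha> / a\<^sup>2) * Q - (\<alpha> * \<Gamma> / a\<^sup>2) * v
        + (2 * \<alpha> * \<Gamma> / a ^ 3) * \<Gamma> - (\<beta> * p * B / a) * v + (\<beta> * p * (p + 1) * B / a\<^sup>2) * \<Gamma> - (- (B\<^sup>2 / a))"
      by (simp only: sum_subtractf sum.distrib sum_distrib_left[symmetric] gsum gK \<Gamma>_def[symmetric]
          HH_def[symmetric] v_def[symmetric] fourth)
    finally have lhs: "(\<Sum>i\<in>UNIV. ?lhs i) = (2 * \<alpha> / a) * HH + (2 * \<alpha> / a) * T - (4 * \<alpha> / a\<^sup>2) * Q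
        - (\<alpha> * \<Gamma> / a\<^sup>2) * v + (2 * \<alpha> * \<Gamma> / a ^ 3) * \<Gamma> - (\<beta> * p * B / a) * v
        + (\<beta> * p * (p + 1) * B / a\<^sup>2) * \<Gamma> - (- (B\<^sup>2 / a))" .
    have lhs: "a * (\<Sum>i\<in>UNIV. ?lhs i) = \<alpha> * (2 * HH + 2 * T - 4 * (Q / a) - (\<Gamma> / a) * v + 2 * (\<Gamma> / a)\<^sup>2)
      - \<beta> * p * (B * v - (p + 1) * B * (\<Gamma> / a)) + B\<^sup>2"
      unfolding lhs using a by (simp add: divide_simps) (simp add: algebra_simps eval_nat_numeral)
    have "(\<Sum>i\<in>UNIV. ?rhs i) = (\<Sum>i\<in>UNIV. (W * \<theta>\<^sup>2 / a\<^sup>2) * (g i)\<^sup>2 + (2 * W * \<theta> / a) * (g i * \<tau> i)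
        + W * (\<tau> i)\<^sup>2 + (W * \<theta> / a) * H i i - (W * \<theta> / a\<^sup>2) * (g i)\<^sup>2 + W * l i)"
      by (intro sum.cong refl) (simp add: power2_eq_square add_divide_distrib diff_divide_distrib algebra_simps)
    also have "\<dots> = (W * \<theta>\<^sup>2 / a\<^sup>2) * \<Gamma> + (2 * W * \<theta> / a) * X + W * N + (W * \<theta> / a) * v
        - (W * \<theta> / a\<^sup>2) * \<Gamma> + W * L"
      by (simp only: sum_subtractf sum.distrib sum_distrib_left[symmetric] \<Gamma>_def[symmetric]
          X_def[symmetric] N_def[symmetric] v_def[symmetric] L_def[symmetric])
    finally have rhs: "(\<Sum>i\<in>UNIV. ?rhs i) = (W * \<theta>\<^sup>2 / a\<^sup>2) * \<Gamma> + (2 * W * \<theta> / a) * X + W * N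
        + (W * \<theta> / a) * v - (W * \<theta> / a\<^sup>2) * \<Gamma> + W * L" .
    have "a * ((W * \<theta>\<^sup>2 / a\<^sup>2) * \<Gamma> + (2 * W * \<theta> / a) * X + W * N + (W * \<theta> / a) * v
        - (W * \<theta> / a\<^sup>2) * \<Gamma> + W * L) = W * (\<theta>\<^sup>2 * (\<Gamma> / a) + 2 * \<theta> * X + a * N + \<theta> * v - \<theta> * (\<Gamma> / a) + a * L)"
      using a by (simp add: divide_simps) (simp add: algebra_simps eval_nat_numeral)
    with le show ?thesis
      unfolding lhs rhs by simp
  qed
  have hessian: "(1 / n) * (v - (1 - \<alpha>) * (\<Gamma> / a))\<^sup>2
      \<le> HH - 2 * (1 - \<alpha>) * (Q / a) + (1 - \<alpha>)\<^sup>2 * (\<Gamma> / a)\<^sup>2"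
    using hessian_trace_inequality[of H "(1 - \<alpha>) / a" g, folded \<Gamma>_def Q_def HH_def v_def n_def]
    by (simp add: power_divide)
  have v: "v = \<alpha> * (\<Gamma> / a) + \<beta> * B - W"
  proof -
    have "v = laplacian u x" by (simp add: v_def H_def laplacian_def)
    then show ?thesis
      by (simp add: W_def defect_def norm_gradient_square \<Gamma>_def g_def B_def a_def)
  qed
  have \<Gamma>: "\<Gamma> \<ge> 0" and N0: "N \<ge> 0" by (simp_all add: \<Gamma>_def N_def sum_nonneg)
  have \<theta>0: "\<theta> > 0" using \<alpha> \<theta> by simp
  have main: "\<theta> * W + \<theta>\<^sup>2 * (\<Gamma> / a) \<le> 2 * (\<alpha> + \<theta>) * X + a * N + a * L"
  proof (rule touching_point_scalar_inequality[OF _ B _ \<alpha> \<beta> _ \<theta> _ _ _ first second hessian v])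
    show "W > 0" using w by (simp add: W_def)
    show "\<Gamma> / a \<ge> 0" "1 / n \<ge> 0" using \<Gamma> a n by simp_all
    show "p \<ge> 1 + 4 * \<alpha> * (1 / n)" using p by (simp add: n_def)
    show "p\<^sup>2 + p * (1 - 3 * \<alpha>) - \<alpha> - 4 * \<alpha> * (1 - 2 * \<alpha>) * (1 / n) \<ge> 0"
      using mixed by (simp add: n_def)
    show "\<beta>\<^sup>2 * (p - 2 * \<alpha> * (1 / n)) \<le> 1" using \<beta>2 by (simp add: n_def)
  qed
  have cross: "2 * (\<alpha> + \<theta>) * X \<le> \<theta>\<^sup>2 * (\<Gamma> / a) + (\<alpha> + \<theta>)\<^sup>2 / \<theta>\<^sup>2 * (a * N)"
  proof -
    have "(\<Sum>i\<in>UNIV. 2 * (\<alpha> + \<theta>) * (g i * \<tau> i))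
        \<le> (\<Sum>i\<in>UNIV. \<theta>\<^sup>2 / a * (g i)\<^sup>2 + (\<alpha> + \<theta>)\<^sup>2 / \<theta>\<^sup>2 * a * (\<tau> i)\<^sup>2)"
    proof (rule sum_mono)
      fix i
      have "0 \<le> (\<theta>\<^sup>2 * g i - (\<alpha> + \<theta>) * a * \<tau> i)\<^sup>2 / (\<theta>\<^sup>2 * a)"
        using a by simp
      also have "\<dots> = \<theta>\<^sup>2 / a * (g i)\<^sup>2 + (\<alpha> + \<theta>)\<^sup>2 / \<theta>\<^sup>2 * a * (\<tau> i)\<^sup>2 - 2 * (\<alpha> + \<theta>) * (g i * \<tau> i)"
        using a \<theta>0 by (simp add: divide_simps) (simp add: algebra_simps eval_nat_numeral)
      finally show "2 * (\<alpha> + \<theta>) * (g i * \<tau> i)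
          \<le> \<theta>\<^sup>2 / a * (g i)\<^sup>2 + (\<alpha> + \<theta>)\<^sup>2 / \<theta>\<^sup>2 * a * (\<tau> i)\<^sup>2" by simp
    qed
    then show ?thesis
      by (simp only: sum.distrib sum_distrib_left[symmetric] X_def[symmetric] \<Gamma>_def[symmetric] N_def[symmetric])
        (simp add: mult.assoc)
  qed
  have r: "(norm (x - y))\<^sup>2 < R\<^sup>2"
  proof (rule power_strict_mono)
    show "norm (x - y) < R" using x by (simp add: dist_norm norm_minus_commute)
  qed auto
  have sq: "(\<Sum>i\<in>UNIV. ((x - y) $ i)\<^sup>2) = (norm (x - y))\<^sup>2"
    unfolding power2_norm_eq_inner by (simp add: inner_vec_def power2_eq_square)
  have \<rho>: "0 < \<rho>" "\<rho> \<le> R\<^sup>2" using r by (simp_all add: \<rho>_def)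
  have "N = 16 / \<rho>\<^sup>2 * (norm (x - y))\<^sup>2"
    unfolding N_def \<tau>_def sq[symmetric] sum_distrib_left
    by (intro sum.cong refl) (simp only: power_divide power_mult_distrib, simp)
  then have N: "N * \<rho>\<^sup>2 \<le> 16 * R\<^sup>2" using \<rho> r by simp
  have "L = n * (4 / \<rho>) + 8 / \<rho>\<^sup>2 * (norm (x - y))\<^sup>2"
    unfolding L_def l_def sq[symmetric] n_def by (simp add: sum.distrib sum_distrib_left)
  then have "L * \<rho>\<^sup>2 = 4 * n * \<rho> + 8 * (norm (x - y))\<^sup>2"
    using \<rho> by (simp add: field_simps power2_eq_square)
  also have "\<dots> \<le> 4 * n * R\<^sup>2 + 8 * R\<^sup>2"
    using \<rho> r n by (intro add_mono mult_left_mono) auto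
  finally have L: "L * \<rho>\<^sup>2 \<le> (4 * n + 8) * R\<^sup>2" by (simp add: algebra_simps)
  define C where "C = (\<alpha> + \<theta>)\<^sup>2 / \<theta>\<^sup>2"
  have C: "C \<ge> 0" by (simp add: C_def)
  have "\<theta> * W \<le> a * ((C + 1) * N + L)"
    using main cross unfolding C_def[symmetric] by (simp add: algebra_simps)
  then have "\<theta> * W * \<rho>\<^sup>2 \<le> a * ((C + 1) * N + L) * \<rho>\<^sup>2"
    by (intro mult_right_mono) auto
  also have "\<dots> = a * ((C + 1) * (N * \<rho>\<^sup>2) + L * \<rho>\<^sup>2)" by (simp add: algebra_simps)
  also have "\<dots> \<le> a * ((C + 1) * (16 * R\<^sup>2) + (4 * n + 8) * R\<^sup>2)"
    using a C N L by (intro mult_left_mono add_mono) auto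
  also have "\<dots> = (16 * C + 24 + 4 * n) * a * R\<^sup>2" by (simp add: algebra_simps)
  finally show ?thesis by (simp add: W_def \<rho>_def C_def a_def n_def)
qed

text \<open>If the defect were positive at \<open>y\<close>, touching it on each ball around \<open>y\<close> by the lowest barrier above
  it would give \<open>c R powr (2 \<theta>) \<le> D\<close> for all \<open>R \<ge> 1\<close> with \<open>c > 0\<close>. Quadratic growth of
  \<open>u\<close> is what makes the exponent \<open>2 \<theta>\<close> positive.\<close>

lemma defect_nonpos:
  fixes u :: "real ^ 'n \<Rightarrow> real" and \<alpha> \<beta> p :: real
  assumes u: "C_k 4 u" and pos: "\<And>z. u z > 0"
    and eq: "\<And>z. - bilaplacian u z = u z powr (- (2 * p + 1))"
    and \<alpha>: "0 \<le> \<alpha>" "\<alpha> < 1 / 3" and \<beta>: "\<beta> > 0"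
    and p: "p \<ge> 1 + 4 * \<alpha> / real CARD('n)"
    and mixed: "p\<^sup>2 + p * (1 - 3 * \<alpha>) - \<alpha> - 4 * \<alpha> * (1 - 2 * \<alpha>) / real CARD('n) \<ge> 0"
    and \<beta>2: "\<beta>\<^sup>2 * (p - 2 * \<alpha> / real CARD('n)) \<le> 1"
  shows "defect \<alpha> \<beta> p u y \<le> 0"
proof (rule ccontr)
  assume "\<not> defect \<alpha> \<beta> p u y \<le> 0"
  then have W0: "defect \<alpha> \<beta> p u y > 0" by simp
  define \<theta> where "\<theta> = (1 - 3 * \<alpha>) / 2"
  have \<theta>: "0 < \<theta>" "\<theta> < 1" using \<alpha> by (simp_all add: \<theta>_def)
  define C where "C = 16 * (\<alpha> + \<theta>)\<^sup>2 / \<theta>\<^sup>2 + 24 + 4 * real CARD('n)"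
  have C: "C > 0" unfolding C_def by (intro add_nonneg_pos add_nonneg_nonneg) auto
  have "bilaplacian u z \<le> 0" for z using eq[of z] powr_ge_zero[of "u z" "- (2 * p + 1)"] by linarith
  then obtain K where K: "K > 0" "\<And>R z. R \<ge> 1 \<Longrightarrow> dist y z \<le> R \<Longrightarrow> u z \<le> K * R\<^sup>2"
    using quadratic_growth[OF u pos] by blast
  define c where "c = \<theta> * (defect \<alpha> \<beta> p u y * u y powr (- \<theta>))"
  have c: "c > 0" using W0 \<theta> pos[of y] by (simp add: c_def)
  have cu: "continuous_on S u" "continuous_on S (partial_deriv i u)" "continuous_on S (laplacian u)" for S i
    using C_k_continuous[OF u] C_k_continuous[of 3 "partial_deriv i u"] C_k_continuous[OF C_k_laplacian[of 2 u]] u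
    by (auto simp: eval_nat_numeral intro: continuous_on_subset)
  have ne: "u z \<noteq> 0" for z using pos[of z] by simp
  have growth: "c * R ^ 4 \<le> C * (K * R\<^sup>2) powr (1 - \<theta>) * R\<^sup>2" if R: "R \<ge> 1" for R
  proof -
    define \<rho> where "\<rho> z = R\<^sup>2 - (norm (z - y))\<^sup>2" for z
    define P where "P z = defect \<alpha> \<beta> p u z * u z powr (- \<theta>) * (\<rho> z)\<^sup>2" for z
    have "continuous_on (cball y R) P"
      unfolding P_def defect_def norm_gradient_square \<rho>_def
      by (intro continuous_intros cu) (auto simp: ne)
    then obtain x where x: "x \<in> cball y R" "\<And>z. z \<in> cball y R \<Longrightarrow> P z \<le> P x"
      using continuous_attains_sup[of "cball y R" P] R by auto
    have Py: "\<theta> * P y = c * R ^ 4" by (simp add: P_def \<rho>_def c_def)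
    then have "\<theta> * P y > 0" using c R by simp
    then have "P y > 0" using \<theta> by (simp add: zero_less_mult_iff)
    then have Px: "P x > 0" using x(2)[of y] R by simp
    have "norm (x - y) \<le> R" using x(1) by (simp add: dist_norm norm_minus_commute)
    moreover have "norm (x - y) \<noteq> R" using Px by (auto simp: P_def \<rho>_def)
    ultimately have xb: "x \<in> ball y R" by (simp add: dist_norm norm_minus_commute)
    have \<rho>: "\<rho> z > 0" if "z \<in> ball y R" for z
    proof -
      have "norm (z - y) < R" using that by (simp add: dist_norm norm_minus_commute)
      then have "(norm (z - y))\<^sup>2 < R\<^sup>2" by (intro power_strict_mono) auto
      then show ?thesis by (simp add: \<rho>_def)
    qed
    have P: "defect \<alpha> \<beta> p u z = P z * u z powr \<theta> / (\<rho> z)\<^sup>2" if "z \<in> ball y R" for z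
      using \<rho>[OF that] ne[of z] by (simp add: P_def powr_minus field_simps)
    have "P x * u x powr \<theta> / (\<rho> x)\<^sup>2 > 0" using Px pos[of x] \<rho>[OF xb] by simp
    with P[OF xb] have W: "defect \<alpha> \<beta> p u x > 0" by simp
    have "\<theta> * defect \<alpha> \<beta> p u x * (R\<^sup>2 - (norm (x - y))\<^sup>2)\<^sup>2
        \<le> (16 * (\<alpha> + \<theta>)\<^sup>2 / \<theta>\<^sup>2 + 24 + 4 * real CARD('n)) * u x * R\<^sup>2"
    proof (rule touching_point_bound[OF u pos eq \<alpha> \<beta> \<theta>_def p mixed \<beta>2 xb _ _ W])
      show "defect \<alpha> \<beta> p u x = barrier (P x) \<theta> u y R x"
        unfolding barrier_def \<rho>_def[symmetric] by (rule P[OF xb])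
      fix z assume z: "z \<in> ball y R"
      show "defect \<alpha> \<beta> p u z \<le> barrier (P x) \<theta> u y R z"
        unfolding barrier_def \<rho>_def[symmetric] P[OF z]
        using z by (intro divide_right_mono mult_right_mono x(2)) auto
    qed
    then have "\<theta> * defect \<alpha> \<beta> p u x * (\<rho> x)\<^sup>2 \<le> C * u x * R\<^sup>2"
      by (simp only: C_def \<rho>_def)
    then have "\<theta> * defect \<alpha> \<beta> p u x * (\<rho> x)\<^sup>2 * u x powr (- \<theta>) \<le> C * u x * R\<^sup>2 * u x powr (- \<theta>)"
      by (rule mult_right_mono) simp
    moreover have "\<theta> * P x = \<theta> * defect \<alpha> \<beta> p u x * (\<rho> x)\<^sup>2 * u x powr (- \<theta>)"
      by (simp add: P_def)
    moreover have "C * u x * R\<^sup>2 * u x powr (- \<theta>) = C * u x powr (1 - \<theta>) * R\<^sup>2"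
      using pos[of x] by (simp add: powr_diff powr_minus field_simps)
    ultimately have "\<theta> * P x \<le> C * u x powr (1 - \<theta>) * R\<^sup>2" by (simp only:)
    also have "\<dots> \<le> C * (K * R\<^sup>2) powr (1 - \<theta>) * R\<^sup>2"
      using K(2)[OF R, of x] x(1) pos[of x] \<theta> C
      by (intro mult_right_mono mult_left_mono powr_mono2) auto
    finally have "\<theta> * P x \<le> C * (K * R\<^sup>2) powr (1 - \<theta>) * R\<^sup>2" .
    moreover have "\<theta> * P y \<le> \<theta> * P x" using x(2)[of y] R \<theta> by simp
    ultimately show ?thesis using Py by simp
  qed
  define D where "D = C * K powr (1 - \<theta>)"
  have D: "D > 0" using C K by (simp add: D_def)
  have bounded: "c * R powr (2 * \<theta>) \<le> D" if R: "R \<ge> 1" for R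
  proof -
    have R4: "R ^ 4 = R powr (2 * \<theta>) * R powr (4 - 2 * \<theta>)"
      using R by (simp add: powr_add[symmetric])
    have "(R\<^sup>2) powr (1 - \<theta>) * R\<^sup>2 = R powr (2 * (1 - \<theta>)) * R powr 2"
      using R by (simp add: powr_powr flip: powr_numeral)
    also have "\<dots> = R powr (4 - 2 * \<theta>)"
      by (simp add: powr_add[symmetric] algebra_simps)
    finally have "C * (K * R\<^sup>2) powr (1 - \<theta>) * R\<^sup>2 = D * R powr (4 - 2 * \<theta>)"
      using K R by (simp add: D_def powr_mult mult.assoc)
    with growth[OF R] have "c * R powr (2 * \<theta>) * R powr (4 - 2 * \<theta>) \<le> D * R powr (4 - 2 * \<theta>)"
      unfolding R4 by (simp add: mult.assoc)
    then show ?thesis using R by simp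
  qed
  \<comment> \<open>Chosen so that \<open>c R powr (2 \<theta>)\<close> equals \<open>D + c\<close>.\<close>
  define R where "R = (D / c + 1) powr (1 / (2 * \<theta>))"
  have "R \<ge> 1" unfolding R_def using D c \<theta> by (intro ge_one_powr_ge_zero) auto
  moreover have "R powr (2 * \<theta>) = D / c + 1"
    using D c \<theta> by (simp add: R_def powr_powr add_pos_pos less_imp_le)
  ultimately have "c * (D / c + 1) \<le> D" using bounded[of R] by simp
  moreover have "c * (D / c + 1) = D + c" using c by (simp add: distrib_left)
  ultimately show False using c by linarith
qed

text \<open>For \<open>n \<ge> 4\<close> and \<open>b = n\<^sup>2 + 4 n - 4\<close>, the bound \<open>sqrt (b\<^sup>2 + 64 n) \<le> b + 16 / 3\<close> follows from
  \<open>6 n \<le> b\<close>; for \<open>n = 3\<close> use \<open>sqrt 13 \<le> 4\<close>.\<close>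

lemma coefficient_less_one_third:
  fixes \<alpha> :: real and n :: nat
  assumes "n \<ge> 3"
    and "n \<ge> 4 \<Longrightarrow>
      \<alpha> < (- ((real n)\<^sup>2 + 4 * real n - 4)
            + sqrt (((real n)\<^sup>2 + 4 * real n - 4)\<^sup>2 + 64 * real n)) / 16"
    and "n = 3 \<Longrightarrow> \<alpha> < (- 7 + 2 * sqrt 13) / 4"
  shows "\<alpha> < 1 / 3"
proof (cases "n = 3")
  case True
  have "sqrt 13 \<le> 4" by (rule real_le_lsqrt) auto
  moreover have "4 * \<alpha> < - 7 + 2 * sqrt 13" using assms(3)[OF True] by (simp add: field_simps)
  ultimately show ?thesis by linarith
next
  case False
  then have n: "n \<ge> 4" using assms(1) by simp
  define b where "b = (real n)\<^sup>2 + 4 * real n - 4"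
  have "(real n - 4) * (real n + 2) \<ge> 0" using n by (intro mult_nonneg_nonneg) auto
  then have b: "b \<ge> 6 * real n" by (simp add: b_def power2_eq_square algebra_simps)
  have "sqrt (b\<^sup>2 + 64 * real n) \<le> b + 16 / 3"
    using b by (intro real_le_lsqrt) (auto simp: power2_eq_square algebra_simps)
  moreover have "16 * \<alpha> < - b + sqrt (b\<^sup>2 + 64 * real n)"
    using assms(2)[OF n, folded b_def] by (simp add: field_simps)
  ultimately show ?thesis by linarith
qed

theorem corollary1p2:
  fixes u :: "real ^ 'n \<Rightarrow> real" and n :: nat and q \<alpha> \<beta> :: real
  assumes "CARD('n) = n" and "n \<ge> 3"
    and "q > 1" and "\<alpha> \<ge> 0" and "\<beta> > 0"
    and "n \<ge> 4 \<Longrightarrow>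
      \<alpha> < (- ((real n)\<^sup>2 + 4 * real n - 4)
            + sqrt (((real n)\<^sup>2 + 4 * real n - 4)\<^sup>2 + 64 * real n)) / 16"
    and "n = 3 \<Longrightarrow> \<alpha> < (- 7 + 2 * sqrt 13) / 4"
    and "\<beta> \<le> sqrt (2 / (q - 1 - 4 * \<alpha> / real n))"
    and "q \<ge> max (8 * \<alpha> / real n + 3)
                  (3 * \<alpha> + sqrt (9 * \<alpha>\<^sup>2 + (1 - 2 * \<alpha>) * (1 + 16 * \<alpha> / real n)))"
    and "C_k 4 u" and "\<And>x. u x > 0"
    and "\<And>x. - bilaplacian u x = u x powr (- q)"
  shows "\<forall>x. laplacian u x \<ge> \<alpha> * (norm (gradient u x))\<^sup>2 / u x
                             + \<beta> * u x powr (- ((q - 1) / 2))"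
proof
  fix x
  define p where "p = (q - 1) / 2"
  define k where "k = \<alpha> / real n"
  have \<alpha>: "\<alpha> < 1 / 3" by (rule coefficient_less_one_third[OF assms(2,6,7)])
  have k: "k \<ge> 0" using assms by (simp add: k_def)
  have k_eq: "8 * \<alpha> / real n = 8 * k" "4 * \<alpha> / real n = 4 * k" "16 * \<alpha> / real n = 16 * k"
    "2 * \<alpha> / real n = 2 * k" by (simp_all add: k_def)
  have q: "q \<ge> 8 * k + 3" "q \<ge> 3 * \<alpha> + sqrt (9 * \<alpha>\<^sup>2 + (1 - 2 * \<alpha>) * (1 + 16 * k))"
    using assms(9) by (simp_all add: k_eq)
  have "defect \<alpha> \<beta> p u x \<le> 0"
  proof (rule defect_nonpos[OF assms(10,11)])
    show "- bilaplacian u z = u z powr (- (2 * p + 1))" for z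
    proof -
      have "2 * p + 1 = q" by (simp add: p_def field_simps)
      then show ?thesis using assms(12) by (simp only:)
    qed
    show "p \<ge> 1 + 4 * \<alpha> / real CARD('n)"
      unfolding assms(1) k_eq using q by (simp add: p_def)
    have "sqrt (9 * \<alpha>\<^sup>2 + (1 - 2 * \<alpha>) * (1 + 16 * k)) \<le> q - 3 * \<alpha>" using q by simp
    then have "9 * \<alpha>\<^sup>2 + (1 - 2 * \<alpha>) * (1 + 16 * k) \<le> (q - 3 * \<alpha>)\<^sup>2"
      by (rule sqrt_le_D)
    \<comment> \<open>The lower bound for \<open>q\<close> is the larger root in \<open>q\<close> of the coefficient of \<open>G B\<close>.\<close>
    also have "(q - 3 * \<alpha>)\<^sup>2 = 4 * (p\<^sup>2 + p * (1 - 3 * \<alpha>) - \<alpha> - 4 * (1 - 2 * \<alpha>) * k)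
        + (9 * \<alpha>\<^sup>2 + (1 - 2 * \<alpha>) * (1 + 16 * k))"
      by (simp add: p_def power2_eq_square field_simps)
    finally have "p\<^sup>2 + p * (1 - 3 * \<alpha>) - \<alpha> - 4 * (1 - 2 * \<alpha>) * k \<ge> 0" by simp
    moreover have "4 * \<alpha> * (1 - 2 * \<alpha>) / real n = 4 * (1 - 2 * \<alpha>) * k"
      by (simp add: k_def)
    ultimately show "p\<^sup>2 + p * (1 - 3 * \<alpha>) - \<alpha> - 4 * \<alpha> * (1 - 2 * \<alpha>) / real CARD('n) \<ge> 0"
      unfolding assms(1) by (simp only:)
    have D: "q - 1 - 4 * k > 0" using q k by simp
    have "\<beta>\<^sup>2 \<le> (sqrt (2 / (q - 1 - 4 * k)))\<^sup>2"
      using assms(5,8) unfolding k_eq by (intro power_mono) auto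
    also have "\<dots> = 2 / (q - 1 - 4 * k)" using D by simp
    finally have "\<beta>\<^sup>2 * (q - 1 - 4 * k) \<le> 2" using D by (simp add: field_simps)
    then show "\<beta>\<^sup>2 * (p - 2 * \<alpha> / real CARD('n)) \<le> 1"
      unfolding assms(1) k_eq by (simp add: p_def field_simps)
  qed (use assms \<alpha> in auto)
  then show "laplacian u x \<ge> \<alpha> * (norm (gradient u x))\<^sup>2 / u x + \<beta> * u x powr (- ((q - 1) / 2))"
    by (simp add: defect_def p_def)
qed

end
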